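(* Let $C_{12},C_{13},C_{23}$ be compatible bivariate copulas, and let $C_{ji}(u,v):=C_{ij}(v,u)$ for $1\le i<j\le 3$. A $3$-copula $\widetilde C$ has bivariate marginals $\widetilde C(u_1,u_2,1)=C_{12}(u_1,u_2)$, $\widetilde C(u_1,1,u_3)=C_{13}(u_1,u_3)$, $\widetilde C(1,u_2,u_3)=C_{23}(u_2,u_3)$ if and only if there exist three families of bivariate copulas $\mathbf C_1=\{C^1_t\}_{t\in[0,1]}$, $\mathbf C_2=\{C^2_t\}_{t\in[0,1]}$, $\mathbf C_3=\{C^3_t\}_{t\in[0,1]}$ such that for all $u_1,u_2,u_3\in[0,1]$, \[ \widetilde C(u_1,u_2,u_3)=(C_{13}\star_{\mathbf C_3}C_{32})(u_1,u_3,u_2)=(C_{12}\star_{\mathbf C_2}C_{23})(u_1,u_2,u_3)=(C_{21}\star_{\mathbf C_1}C_{13})(u_2,u_1,u_3). \]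
   Context: A bivariate copula is a distribution function on $[0,1]^2$ with uniform $[0,1]$ marginals; a $3$-copula is a distribution function on $[0,1]^3$ with uniform $[0,1]$ one-dimensional marginals. Bivariate copulas $C_{12},C_{13},C_{23}$ are compatible if some $3$-copula has them as its bivariate marginals in the sense stated in the claim. For bivariate copulas $A,B$ and a family $\mathbf C=\{C_t\}_{t\in[0,1]}$ of bivariate copulas, $(A\star_{\mathbf C} B)(x,y,z)=\int_{0}^{y} C_t\!\left(\tfrac{\partial}{\partial t} A(x,t),\tfrac{\partial}{\partial t} B(t,z)\right) dt$ (partial derivatives existing a.e.). *)

theory Defs
  imports "HOL-Analysis.Analysis"
begin

definition copula2 :: "(real \<Rightarrow> real \<Rightarrow> real) \<Rightarrow> bool" where
  "copula2 C \<longleftrightarrow>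
     (\<forall>u\<in>{0..1}. C u 0 = 0 \<and> C 0 u = 0 \<and> C u 1 = u \<and> C 1 u = u) \<and>
     (\<forall>u1\<in>{0..1}. \<forall>u2\<in>{0..1}. \<forall>v1\<in>{0..1}. \<forall>v2\<in>{0..1}.
        u1 \<le> u2 \<longrightarrow> v1 \<le> v2 \<longrightarrow> C u2 v2 - C u2 v1 - C u1 v2 + C u1 v1 \<ge> 0)"

definition copula3 :: "(real \<Rightarrow> real \<Rightarrow> real \<Rightarrow> real) \<Rightarrow> bool" where
  "copula3 C \<longleftrightarrow>
     (\<forall>u\<in>{0..1}. \<forall>v\<in>{0..1}. C 0 u v = 0 \<and> C u 0 v = 0 \<and> C u v 0 = 0) \<and>
     (\<forall>u\<in>{0..1}. C u 1 1 = u \<and> C 1 u 1 = u \<and> C 1 1 u = u) \<and>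
     (\<forall>a1\<in>{0..1}. \<forall>b1\<in>{0..1}. \<forall>a2\<in>{0..1}. \<forall>b2\<in>{0..1}. \<forall>a3\<in>{0..1}. \<forall>b3\<in>{0..1}.
        a1 \<le> b1 \<longrightarrow> a2 \<le> b2 \<longrightarrow> a3 \<le> b3 \<longrightarrow>
        C b1 b2 b3 - C a1 b2 b3 - C b1 a2 b3 - C b1 b2 a3
          + C a1 a2 b3 + C a1 b2 a3 + C b1 a2 a3 - C a1 a2 a3 \<ge> 0)"

definition compatible :: "(real \<Rightarrow> real \<Rightarrow> real) \<Rightarrow> (real \<Rightarrow> real \<Rightarrow> real) \<Rightarrow>
    (real \<Rightarrow> real \<Rightarrow> real) \<Rightarrow> bool" where
  "compatible C12 C13 C23 \<longleftrightarrow>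
     (\<exists>C. copula3 C \<and>
        (\<forall>u1\<in>{0..1}. \<forall>u2\<in>{0..1}. \<forall>u3\<in>{0..1}.
           C u1 u2 1 = C12 u1 u2 \<and> C u1 1 u3 = C13 u1 u3 \<and> C 1 u2 u3 = C23 u2 u3))"

text \<open>Star product: (A *_C B)(x,y,z) = int_0^y C_t(d/dt A(x,t), d/dt B(t,z)) dt
  (Lebesgue integral w.r.t. the complete Lebesgue measure; derivatives exist a.e.).\<close>
definition star ::
  "(real \<Rightarrow> real \<Rightarrow> real) \<Rightarrow> (real \<Rightarrow> real \<Rightarrow> real \<Rightarrow> real) \<Rightarrow> (real \<Rightarrow> real \<Rightarrow> real)
     \<Rightarrow> real \<Rightarrow> real \<Rightarrow> real \<Rightarrow> real" where
  "star A Cf B x y z =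
     (LINT t:{0..y}|lebesgue. Cf t (deriv (\<lambda>s. A x s) t) (deriv (\<lambda>s. B s z) t))"

end

theory Submission
  imports Defs
begin

text \<open>Sections of copulas are nondecreasing and 1-Lipschitz, hence differentiable almost everywhere and
  equal to the integral of their derivative. Setting a variable to 1 therefore recovers the marginals
  from the star products.

  Conversely, let \<open>K\<close> be a 3-copula. For almost every \<open>t\<close> the derivatives
  \<open>H t x z\<close> of \<open>K x t z\<close> in \<open>t\<close> exist for all rational \<open>x, z\<close>, and \<open>H t\<close> is a joint
  distribution function with marginals \<open>H t x 1\<close> and \<open>H t 1 z\<close>. Sklar's theorem gives a
  copula with \<open>C\<^sub>t (H t x 1) (H t 1 z) = H t x z\<close>. For fixed real \<open>x, z\<close> this
  extends to almost every \<open>t\<close> by rational approximation from above, and integration over \<open>t\<close> gives \<open>K\<close>.\<close>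

subsection \<open>Lebesgue differentiation on the line\<close>

lemma short_map_continuous:
  fixes f :: "real \<Rightarrow> real"
  assumes "\<And>s t. s \<le> t \<Longrightarrow> 0 \<le> f t - f s \<and> f t - f s \<le> t - s"
  shows "continuous_on UNIV f"
proof -
  have "\<bar>f y - f x\<bar> \<le> \<bar>y - x\<bar>" for x y
    using assms[of x y] assms[of y x] by (cases "x \<le> y") auto
  then have "1-lipschitz_on UNIV f"
    by (intro lipschitz_onI) (auto simp: dist_real_def abs_minus_commute)
  then show ?thesis by (rule lipschitz_on_continuous_on)
qed

text \<open>The complement \<open>t - f t\<close> is again nondecreasing and 1-Lipschitz, which
  makes the measure of \<open>f\<close> a summand of Lebesgue measure; a summand vanishes wherever
  the sum does.\<close>

lemma interval_measure_short_map_absolutely_continuous: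
  fixes f :: "real \<Rightarrow> real"
  assumes f: "\<And>s t. s \<le> t \<Longrightarrow> 0 \<le> f t - f s \<and> f t - f s \<le> t - s"
  shows "absolutely_continuous lborel (interval_measure f)"
proof -
  define g where "g t = t - f t" for t
  have g: "s \<le> t \<Longrightarrow> 0 \<le> g t - g s \<and> g t - g s \<le> t - s" for s t
    using f[of s t] by (auto simp: g_def)
  have mono: "\<And>x y. x \<le> y \<Longrightarrow> f x \<le> f y" "\<And>x y. x \<le> y \<Longrightarrow> g x \<le> g y"
    using f g by fastforce+
  have cont: "continuous_on UNIV f" "continuous_on UNIV g"
    using short_map_continuous f g by blast+
  have right: "\<And>a. continuous (at_right a) f" "\<And>a. continuous (at_right a) g"
    using cont by (auto simp: continuous_on_eq_continuous_within continuous_at_imp_continuous_within)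
  \<comment> \<open>The Stieltjes measures of \<open>f\<close> and of \<open>t - f t\<close> add up to Lebesgue measure.\<close>
  define M where "M = measure_of UNIV (sets borel)
    (\<lambda>A. emeasure (interval_measure f) A + emeasure (interval_measure g) A)"
  have sM: "sets M = sets borel"
    by (simp add: M_def sets.sigma_sets_eq[of borel, simplified])
  have eM: "emeasure M A = emeasure (interval_measure f) A + emeasure (interval_measure g) A"
    if "A \<in> sets borel" for A
    unfolding M_def
  proof (rule emeasure_measure_of_sigma)
    show "sigma_algebra UNIV (sets (borel :: real measure))"
      using sets.sigma_algebra_axioms[of "borel :: real measure"] by simp
    show "countably_additive (sets borel)
        (\<lambda>A. emeasure (interval_measure f) A + emeasure (interval_measure g) A)"
    proof (rule countably_additiveI)
      fix A :: "nat \<Rightarrow> real set"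
      assume "range A \<subseteq> sets borel" "disjoint_family A"
      then show "(\<Sum>i. emeasure (interval_measure f) (A i) + emeasure (interval_measure g) (A i)) =
          emeasure (interval_measure f) (\<Union> (range A)) + emeasure (interval_measure g) (\<Union> (range A))"
        by (subst suminf_add[symmetric]) (auto simp: suminf_emeasure)
    qed
  qed (auto simp: positive_def that)
  have "lborel = M"
  proof (rule lborel_eqI)
    fix l u :: real assume lu: "\<And>b. b \<in> Basis \<Longrightarrow> l \<bullet> b \<le> u \<bullet> b"
    then have lu: "l \<le> u" by simp
    have "emeasure M {l..u} = (f u - f l) + (g u - g l)"
      using lu f[of l u] g[of l u]
      by (simp add: eM emeasure_interval_measure_Icc mono cont ennreal_plus[symmetric] del: ennreal_plus)
    \<comment> \<open>Continuity of \<open>f\<close> and \<open>g\<close> rules out atoms, so the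
      open box that characterises Lebesgue measure has the mass of the closed interval.\<close>
    moreover have "emeasure M {x} = 0" for x
      using eM[of "{x}"] emeasure_interval_measure_Icc[of x x f] emeasure_interval_measure_Icc[of x x g]
      by (simp add: mono cont)
    moreover have "{l..u} = box l u \<union> ({l} \<union> {u})"
      using lu by (auto simp: box_real)
    moreover have "emeasure M (box l u \<union> ({l} \<union> {u})) = emeasure M (box l u)"
      using calculation(2)
      by (intro emeasure_Un_null_set null_sets.Un) (auto simp: null_sets_def sM)
    ultimately show "emeasure M (box l u) = ennreal (\<Prod>b\<in>Basis. (u - l) \<bullet> b)"
      by (simp add: g_def)
  qed (simp add: sM)
  then have "emeasure (interval_measure f) A = 0" if "A \<in> sets borel" "emeasure lborel A = 0" for A
    using eM[OF that(1)] that(2) by auto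
  then show ?thesis
    by (auto simp: absolutely_continuous_def null_sets_def)
qed

text \<open>This is the Radon-Nikodym density of the Stieltjes measure, converted from extended to
  real values. Nonnegativity is recorded because it later upgrades Henstock-Kurzweil integrability
  to absolute integrability.\<close>

lemma short_map_density:
  fixes f :: "real \<Rightarrow> real"
  assumes f: "\<And>s t. s \<le> t \<Longrightarrow> 0 \<le> f t - f s \<and> f t - f s \<le> t - s"
  obtains g where "g \<in> borel_measurable borel" "\<And>x. 0 \<le> g x"
    "\<And>a b. a \<le> b \<Longrightarrow> (g has_integral (f b - f a)) {a..b}"
proof -
  have mono: "\<And>x y. x \<le> y \<Longrightarrow> f x \<le> f y" using f by fastforce
  have cont: "continuous_on UNIV f" using short_map_continuous f by blast
  obtain h where h: "h \<in> borel_measurable lborel" "density lborel h = interval_measure f"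
    using sigma_finite_measure.Radon_Nikodym[OF sigma_finite_lborel interval_measure_short_map_absolutely_continuous[OF f]]
    by auto
  have hm[measurable]: "h \<in> borel_measurable borel" using h(1) by simp
  have I: "(\<integral>\<^sup>+x. h x * indicator {a..b} x \<partial>lborel) = ennreal (f b - f a)" if "a \<le> b" for a b
    using emeasure_interval_measure_Icc[OF that mono cont]
    by (simp add: h(2)[symmetric] emeasure_density)
  \<comment> \<open>The density has finite integral over each bounded interval, so it is infinite
    only on a null set, where \<open>enn2real\<close> may alter it freely.\<close>
  have fin: "AE x in lborel. h x < \<infinity>"
  proof -
    have "AE x in lborel. h x * indicator {- real n..real n} x \<noteq> \<infinity>" for n
      by (rule nn_integral_noteq_infinite) (auto simp: I)
    then have "AE x in lborel. \<forall>n. h x * indicator {- real n..real n} x \<noteq> \<infinity>"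
      by (simp add: AE_all_countable)
    then show ?thesis
    proof (rule AE_mp[OF _ AE_I2], intro impI)
      fix x assume A: "\<forall>n. h x * indicator {- real n..real n} x \<noteq> \<infinity>"
      obtain n where "\<bar>x\<bar> \<le> real n" using real_arch_simple by blast
      then have "x \<in> {- real n..real n}" by auto
      then show "h x < \<infinity>" using A[rule_format, of n] by (simp add: less_top)
    qed
  qed
  show thesis
  proof
    show "(\<lambda>x. enn2real (h x)) \<in> borel_measurable borel" by measurable
    show "0 \<le> enn2real (h x)" for x by simp
    fix a b :: real assume ab: "a \<le> b"
    have "(\<integral>\<^sup>+x. ennreal (enn2real (h x) * indicator {a..b} x) \<partial>lborel)
        = (\<integral>\<^sup>+x. h x * indicator {a..b} x \<partial>lborel)"
      by (rule nn_integral_cong_AE, rule AE_mp[OF fin AE_I2]) (auto simp: indicator_def)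
    then have "((\<lambda>x. enn2real (h x) * indicator {a..b} x) has_integral (f b - f a)) UNIV"
      using f[OF ab] by (intro nn_integral_has_integral) (auto simp: I ab)
    moreover have "(\<lambda>x. enn2real (h x) * indicator {a..b} x)
        = (\<lambda>x. if x \<in> {a..b} then enn2real (h x) else 0)"
      by (auto simp: fun_eq_iff indicator_def)
    ultimately show "((\<lambda>x. enn2real (h x)) has_integral (f b - f a)) {a..b}"
      by (simp only: has_integral_restrict_UNIV)
  qed
qed

section \<open>Almost everywhere differentiation of indefinite integrals\<close>

text \<open>The Henstock lemma bounds the total length of finitely many disjoint intervals on which the
  integral deviates from its Riemann term by the factor \<open>\<delta>\<close>; a Vitali cover by such
  intervals transfers the bound to the exceptional set, measurable or not.\<close>

lemma negligible_large_difference_quotient: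
  fixes g :: "real \<Rightarrow> real" and \<delta> :: real
  assumes g: "g integrable_on {a..b}" and \<delta>: "0 < \<delta>"
    and S: "\<And>x \<eta>. x \<in> S \<Longrightarrow> 0 < \<eta> \<Longrightarrow> \<exists>u v. a \<le> u \<and> u < v \<and> v \<le> b \<and> v - u < \<eta> \<and> (x = u \<or> x = v) \<and>
          \<delta> * (v - u) \<le> \<bar>(v - u) * g x - integral {u..v} g\<bar>"
  shows "negligible S"
  unfolding negligible_outer_le
proof (intro allI impI)
  fix e :: real assume e: "0 < e"
  with \<delta> have "0 < \<delta> * e" by simp
  with g obtain \<gamma> where \<gamma>: "gauge \<gamma>"
    and hen: "\<And>p. \<lbrakk>p tagged_partial_division_of {a..b}; \<gamma> fine p\<rbrakk> \<Longrightarrow>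
       sum (\<lambda>(x,k). norm (measure lborel k *\<^sub>R g x - integral k g)) p < \<delta> * e"
    using Henstock_lemma[of g a b "\<delta> * e"] by auto
  \<comment> \<open>The pairs \<open>i\<close> index closed intervals tagged by an endpoint. Such
    intervals are fine for the gauge and bad for the Riemann sum, so the Henstock lemma applies to
    any finite disjoint family of them.\<close>
  define good where "good x i \<longleftrightarrow> a \<le> fst i \<and> fst i < snd i \<and> snd i \<le> b \<and>
      (x = fst i \<or> x = snd i) \<and> {fst i..snd i} \<subseteq> \<gamma> x \<and>
      \<delta> * (snd i - fst i) \<le> \<bar>(snd i - fst i) * g x - integral {fst i..snd i} g\<bar>"
    for x :: real and i :: "real \<times> real"
  define K where "K = {i. \<exists>x. good x i}"
  define mid where "mid i = (fst i + snd i) / 2" for i :: "real \<times> real"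
  define rad where "rad i = (snd i - fst i) / 2" for i :: "real \<times> real"
  have cball: "cball (mid i) (rad i) = {fst i..snd i}" for i
    by (auto simp: cball_eq_atLeastAtMost mid_def rad_def field_simps)
  have pos: "0 < rad i" if "i \<in> K" for i
    using that by (auto simp: K_def good_def rad_def)
  have vit: "\<exists>i. i \<in> K \<and> x \<in> cball (mid i) (rad i) \<and> rad i < d" if "x \<in> S" "0 < d" for x d
  proof -
    obtain r where r: "0 < r" "ball x r \<subseteq> \<gamma> x"
      using \<gamma> by (meson gauge_def openE)
    have "0 < min r d" using r that by simp
    from S[OF that(1) this] obtain u v where uv: "a \<le> u" "u < v" "v \<le> b" "v - u < min r d"
      "x = u \<or> x = v" "\<delta> * (v - u) \<le> \<bar>(v - u) * g x - integral {u..v} g\<bar>"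
      by blast
    have "{u..v} \<subseteq> ball x r"
      using uv by (auto simp: dist_real_def)
    then have "good x (u, v)" using uv r by (auto simp: good_def)
    moreover have "x \<in> cball (mid (u, v)) (rad (u, v))"
      using uv unfolding cball by auto
    ultimately show ?thesis
      using uv by (intro exI[of _ "(u, v)"]) (auto simp: K_def rad_def)
  qed
  obtain C where C: "countable C" "C \<subseteq> K"
    "pairwise (\<lambda>i j. disjnt (cball (mid i) (rad i)) (cball (mid j) (rad j))) C"
    "negligible (S - (\<Union>i\<in>C. cball (mid i) (rad i)))"
    by (rule Vitali_covering_theorem_cballs[OF pos vit]) auto
  define tag where "tag i = (SOME x. good x i)" for i
  have tag: "good (tag i) i" if "i \<in> C" for i
    using that C(2) unfolding K_def tag_def by (auto intro: someI_ex)
  \<comment> \<open>A bound that is uniform over finite subfamilies carries over to the countable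
    union.\<close>
  have bound: "measure lebesgue (\<Union>i\<in>D. {fst i..snd i}) \<le> e" if D: "D \<subseteq> C" "finite D" for D
  proof -
    have le: "fst i \<le> snd i" if "i \<in> D" for i
      using tag[of i] D(1) that unfolding good_def by auto
    let ?p = "(\<lambda>i. (tag i, {fst i..snd i})) ` D"
    have inj: "inj_on (\<lambda>i. (tag i, {fst i..snd i})) D"
    proof (rule inj_onI)
      fix i j assume "i \<in> D" "j \<in> D" "(tag i, {fst i..snd i}) = (tag j, {fst j..snd j})"
      then show "i = j"
        using tag[of i] tag[of j] D by (auto simp: good_def Icc_eq_Icc prod_eq_iff)
    qed
    have dis: "{fst i..snd i} \<inter> {fst j..snd j} = {}" if "i \<in> D" "j \<in> D" "i \<noteq> j" for i j
      using C(3) that D(1) by (auto simp: pairwise_def cball disjnt_def)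
    have "?p tagged_partial_division_of {a..b}"
      unfolding tagged_partial_division_of_def
    proof (intro conjI allI impI)
      fix x1 K1 x2 K2 assume "(x1, K1) \<in> ?p \<and> (x2, K2) \<in> ?p \<and> (x1, K1) \<noteq> (x2, K2)"
      then show "interior K1 \<inter> interior K2 = {}"
        using dis by (smt (verit) Int_empty_right Int_mono disjoint_iff image_iff interior_subset prod.inject subset_eq)
    next
      fix x J assume "(x, J) \<in> ?p"
      then obtain i where i: "i \<in> D" "x = tag i" "J = {fst i..snd i}" by blast
      have "good x i" using tag[of i] D(1) i(1) unfolding i(2) by blast
      then show "x \<in> J" "J \<subseteq> {a..b}" "\<exists>a b. J = cbox a b"
        using i by (auto simp: good_def)
    qed (use D in auto)
    moreover have "\<gamma> fine ?p"
      using tag D by (auto simp: fine_def good_def)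
    ultimately have "sum (\<lambda>(x,k). norm (measure lborel k *\<^sub>R g x - integral k g)) ?p < \<delta> * e"
      by (rule hen)
    also have "sum (\<lambda>(x,k). norm (measure lborel k *\<^sub>R g x - integral k g)) ?p
       = (\<Sum>i\<in>D. norm (measure lborel {fst i..snd i} *\<^sub>R g (tag i) - integral {fst i..snd i} g))"
      using inj by (subst sum.reindex) auto
    finally have 1: "\<dots> < \<delta> * e" .
    \<comment> \<open>Each chosen interval contributes at least \<open>\<delta>\<close> times its
      length to the Henstock sum, so cancelling \<open>\<delta>\<close> bounds the total length by
      \<open>e\<close>.\<close>
    have "(\<Sum>i\<in>D. \<delta> * (snd i - fst i))
       \<le> (\<Sum>i\<in>D. norm (measure lborel {fst i..snd i} *\<^sub>R g (tag i) - integral {fst i..snd i} g))"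
      using tag D by (intro sum_mono) (force simp: good_def)
    with 1 have "\<delta> * (\<Sum>i\<in>D. snd i - fst i) < \<delta> * e"
      by (simp add: sum_distrib_left)
    then have 2: "(\<Sum>i\<in>D. snd i - fst i) < e" using \<delta> by simp
    have "measure lebesgue (\<Union>i\<in>D. {fst i..snd i}) \<le> (\<Sum>i\<in>D. measure lebesgue {fst i..snd i})"
      using D by (intro measure_UNION_le) auto
    also have "\<dots> = (\<Sum>i\<in>D. snd i - fst i)"
      using le by (intro sum.cong) simp_all
    finally show ?thesis using 2 by simp
  qed
  let ?U = "\<Union>i\<in>C. {fst i..snd i}"
  have U: "?U \<in> lmeasurable" "measure lebesgue ?U \<le> e"
    using fmeasurable_UN_bound[of C "\<lambda>i. {fst i..snd i}" lebesgue e]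
      measure_UN_bound[of C "\<lambda>i. {fst i..snd i}" lebesgue e] C(1) bound by auto
  have N: "negligible (S - ?U)" using C(4) by (simp add: cball)
  show "\<exists>T. S \<subseteq> T \<and> T \<in> lmeasurable \<and> measure lebesgue T \<le> e"
  proof (intro exI conjI)
    show "S \<subseteq> (S - ?U) \<union> ?U" by blast
    show "(S - ?U) \<union> ?U \<in> lmeasurable"
      using N U by (intro fmeasurable.Un) (auto simp: negligible_imp_measurable)
    have "measure lebesgue ((S - ?U) \<union> ?U) \<le> measure lebesgue (S - ?U) + measure lebesgue ?U"
      using N U by (intro measure_Un_le) (auto simp: negligible_imp_sets fmeasurableD)
    then show "measure lebesgue ((S - ?U) \<union> ?U) \<le> e"
      using U(2) negligible_imp_measure0[OF N] by simp
  qed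
qed

text \<open>If the derivative fails at \<open>x\<close>, then for some \<open>n\<close> there are
  points \<open>y\<close> arbitrarily close to \<open>x\<close> whose difference quotient misses
  \<open>g x\<close> by at least \<open>1 / (n + 1)\<close>. Each of these countably many sets
  \<open>B n\<close> is negligible by the preceding lemma.\<close>

proposition lebesgue_differentiation_real:
  fixes g :: "real \<Rightarrow> real"
  assumes g: "g integrable_on {a..b}"
  shows "negligible {x \<in> {a<..<b}. \<not> ((\<lambda>u. integral {a..u} g) has_real_derivative g x) (at x)}"
proof -
  define F where "F u = integral {a..u} g" for u
  have F: "integral {u..v} g = F v - F u" if "a \<le> u" "u \<le> v" "v \<le> b" for u v
  proof -
    have "g integrable_on {a..v}"
      using g that by (auto intro: integrable_subinterval_real)
    then have "integral {a..u} g + integral {u..v} g = integral {a..v} g"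
      using that by (intro Henstock_Kurzweil_Integration.integral_combine) auto
    then show ?thesis by (simp add: F_def)
  qed
  define B where "B n = {x \<in> {a<..<b}. \<forall>\<eta>>0. \<exists>y. y \<noteq> x \<and> \<bar>y - x\<bar> < \<eta> \<and>
      inverse (Suc n) * \<bar>y - x\<bar> \<le> \<bar>(y - x) * g x - (F y - F x)\<bar>}" for n :: nat
  have "negligible (B n)" for n
  proof (rule negligible_large_difference_quotient[OF g, of "inverse (Suc n)"])
    fix x \<eta> :: real assume x: "x \<in> B n" and \<eta>: "0 < \<eta>"
    have "0 < min \<eta> (min (x - a) (b - x))" using x \<eta> by (auto simp: B_def)
    then obtain y where y: "y \<noteq> x" "\<bar>y - x\<bar> < min \<eta> (min (x - a) (b - x))"
      "inverse (Suc n) * \<bar>y - x\<bar> \<le> \<bar>(y - x) * g x - (F y - F x)\<bar>"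
      using x unfolding B_def by blast
    show "\<exists>u v. a \<le> u \<and> u < v \<and> v \<le> b \<and> v - u < \<eta> \<and> (x = u \<or> x = v) \<and>
        inverse (Suc n) * (v - u) \<le> \<bar>(v - u) * g x - integral {u..v} g\<bar>"
    proof (cases "x < y")
      case True
      then show ?thesis
        using y by (intro exI[of _ x] exI[of _ y]) (auto simp: F)
    next
      case False
      have "\<bar>(y - x) * g x - (F y - F x)\<bar> = \<bar>(x - y) * g x - (F x - F y)\<bar>"
        by (subst abs_minus_cancel[symmetric]) (simp add: algebra_simps)
      then show ?thesis
        using y False by (intro exI[of _ y] exI[of _ x]) (auto simp: F)
    qed
  qed simp
  then have "negligible (\<Union>n. B n)" by (intro negligible_countable_Union) auto
  moreover have "(F has_real_derivative g x) (at x)" if x: "a < x" "x < b" "x \<notin> (\<Union>n. B n)" for x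
    unfolding has_field_derivative_iff LIM_def
  proof (intro allI impI)
    fix r :: real assume "0 < r"
    then obtain n where n: "inverse (real (Suc n)) < r"
      using reals_Archimedean by blast
    have "x \<notin> B n" using x by blast
    then have "\<exists>\<eta>>0. \<forall>y. y \<noteq> x \<longrightarrow> \<bar>y - x\<bar> < \<eta> \<longrightarrow>
        \<bar>(y - x) * g x - (F y - F x)\<bar> < inverse (Suc n) * \<bar>y - x\<bar>"
      using x(1,2) unfolding B_def by (auto simp: not_le simp del: of_nat_Suc)
    then obtain \<eta> where \<eta>: "0 < \<eta>" and
      small: "\<And>y. y \<noteq> x \<Longrightarrow> \<bar>y - x\<bar> < \<eta> \<Longrightarrow>
        \<bar>(y - x) * g x - (F y - F x)\<bar> < inverse (Suc n) * \<bar>y - x\<bar>"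
      by blast
    have "\<bar>(F y - F x) / (y - x) - g x\<bar> < r" if "y \<noteq> x" "\<bar>y - x\<bar> < \<eta>" for y
    proof -
      have "\<bar>(F y - F x) / (y - x) - g x\<bar> = \<bar>((F y - F x) - (y - x) * g x) / (y - x)\<bar>"
        using that by (simp add: divide_simps mult.commute)
      also have "\<dots> = \<bar>(y - x) * g x - (F y - F x)\<bar> / \<bar>y - x\<bar>"
        by (simp add: abs_minus_commute abs_divide)
      also have "\<dots> < inverse (Suc n)"
        using small[OF that] that by (simp add: pos_divide_less_eq)
      finally show ?thesis using n by simp
    qed
    with \<eta> show "\<exists>s>0. \<forall>y. y \<noteq> x \<and> dist y x < s \<longrightarrow> dist ((F y - F x) / (y - x)) (g x) < r"
      by (auto simp: dist_real_def)
  qed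
  ultimately show ?thesis
    by (elim negligible_subset) (auto simp: F_def[abs_def])
qed

section \<open>Nondecreasing 1-Lipschitz functions on the unit interval\<close>

text \<open>Short in the metric sense, and nondecreasing. Nothing is required outside the unit
  interval, because copulas are constrained only there.\<close>

definition unit_short :: "(real \<Rightarrow> real) \<Rightarrow> bool" where
  "unit_short f \<longleftrightarrow> (\<forall>s t. 0 \<le> s \<longrightarrow> s \<le> t \<longrightarrow> t \<le> 1 \<longrightarrow> 0 \<le> f t - f s \<and> f t - f s \<le> t - s)"

lemma unit_shortD:
  "unit_short f \<Longrightarrow> 0 \<le> s \<Longrightarrow> s \<le> t \<Longrightarrow> t \<le> 1 \<Longrightarrow> 0 \<le> f t - f s"
  "unit_short f \<Longrightarrow> 0 \<le> s \<Longrightarrow> s \<le> t \<Longrightarrow> t \<le> 1 \<Longrightarrow> f t - f s \<le> t - s"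
  by (auto simp: unit_short_def)

lemma derivative_nonneg_on_unit:
  fixes f :: "real \<Rightarrow> real"
  assumes "\<And>s t. 0 \<le> s \<Longrightarrow> s \<le> t \<Longrightarrow> t \<le> 1 \<Longrightarrow> f s \<le> f t"
    and "(f has_real_derivative d) (at t)" "t \<in> {0<..<1}"
  shows "0 \<le> d"
proof (rule mono_on_imp_deriv_nonneg)
  show "mono_on {0..1} f" using assms(1) by (auto intro: mono_onI)
qed (use assms in auto)

text \<open>The lower bound is monotonicity of \<open>f\<close>; the upper bound is monotonicity of
  \<open>s - f s\<close>.\<close>

lemma unit_short_derivative_bounds:
  assumes f: "unit_short f" and d: "(f has_real_derivative d) (at t)" and t: "t \<in> {0<..<1}"
  shows "d \<in> {0..1}"
proof -
  have "0 \<le> d"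
    using f by (intro derivative_nonneg_on_unit[OF _ d t]) (auto simp: unit_short_def)
  moreover have d': "((\<lambda>s. s - f s) has_real_derivative (1 - d)) (at t)"
    by (intro DERIV_diff d) simp
  have "0 \<le> 1 - d"
    by (rule derivative_nonneg_on_unit[OF _ d' t]) (use unit_shortD(2)[OF f] in \<open>simp add: algebra_simps\<close>)
  ultimately show ?thesis by simp
qed

lemma has_derivative_cong_on_unit:
  fixes f g :: "real \<Rightarrow> real"
  assumes "(f has_real_derivative d) (at t)" "t \<in> {0<..<1}" "\<And>s. s \<in> {0..1} \<Longrightarrow> f s = g s"
  shows "(g has_real_derivative d) (at t)"
  using assms(1) by (rule has_field_derivative_transform_within_open[of _ _ _ "{0<..<1}"])
    (use assms in auto)

text \<open>\<open>deriv\<close> is a choice over all derivatives, so two functions with the same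
  derivatives at \<open>t\<close> get the same value, differentiable or not. As \<open>t\<close> is
  interior, values outside the unit interval do not matter.\<close>

lemma deriv_cong_on_unit:
  fixes f g :: "real \<Rightarrow> real"
  assumes "t \<in> {0<..<1}" "\<And>s. s \<in> {0..1} \<Longrightarrow> f s = g s"
  shows "deriv f t = deriv g t"
proof -
  have "(f has_real_derivative d) (at t) \<longleftrightarrow> (g has_real_derivative d) (at t)" for d
    using has_derivative_cong_on_unit[of f d t g] has_derivative_cong_on_unit[of g d t f] assms by auto
  then show ?thesis by (simp add: deriv_def)
qed

text \<open>Two-sided derivatives are controlled only in the interior, while \<open>star\<close>
  integrates over closed intervals; the endpoints form a null set.\<close>

lemma AE_lebesgue_interior_unit:
  fixes P :: "real \<Rightarrow> bool"
  assumes "AE t in lebesgue. t \<in> {0<..<1} \<longrightarrow> P t"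
  shows "AE t in lebesgue. t \<in> {0..1} \<longrightarrow> P t"
proof -
  have "{0, 1::real} \<in> null_sets lebesgue"
    using negligible_iff_null_sets[of "{0, 1::real}"] by simp
  then have "AE t in lebesgue. t \<notin> {0, 1::real}"
    by (rule AE_not_in)
  then show ?thesis
    using assms by (rule eventually_elim2) auto
qed

text \<open>Completeness of Lebesgue measure lets \<open>g\<close> inherit measurability from
  \<open>f\<close>. Star integrands are known only almost everywhere, so they are evaluated through
  this lemma.\<close>

lemma set_lebesgue_integral_spike:
  fixes f g :: "real \<Rightarrow> real"
  assumes f: "set_integrable lebesgue S f" and ae: "AE t in lebesgue. t \<in> S \<longrightarrow> g t = f t"
  shows "set_integrable lebesgue S g" "(LINT t:S|lebesgue. g t) = (LINT t:S|lebesgue. f t)"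
proof -
  define N where "N = {t. \<not> (t \<in> S \<longrightarrow> g t = f t)}"
  have N: "negligible N"
    using ae by (simp add: completion.AE_iff_null_sets negligible_iff_null_sets N_def)
  have eq: "t \<in> S - N \<Longrightarrow> g t = f t" for t by (auto simp: N_def)
  show g: "set_integrable lebesgue S g"
    using absolutely_integrable_spike[OF f N eq] .
  show "(LINT t:S|lebesgue. g t) = (LINT t:S|lebesgue. f t)"
    unfolding set_lebesgue_integral_eq_integral(2)[OF f] set_lebesgue_integral_eq_integral(2)[OF g]
    using N eq by (intro integral_spike) auto
qed

text \<open>The density of an extension of \<open>f\<close> to the line integrates to the increments
  of \<open>f\<close>, and Lebesgue differentiation identifies it with \<open>deriv f\<close> almost
  everywhere.\<close>

proposition unit_short_differentiation:
  assumes f: "unit_short f"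
  shows unit_short_AE_differentiable:
      "AE t in lebesgue. t \<in> {0<..<1} \<longrightarrow> (f has_real_derivative deriv f t) (at t)"
    and unit_short_deriv_integrable: "0 \<le> y \<Longrightarrow> y \<le> 1 \<Longrightarrow> set_integrable lebesgue {0..y} (deriv f)"
    and unit_short_integral_deriv:
      "0 \<le> y \<Longrightarrow> y \<le> 1 \<Longrightarrow> (LINT t:{0..y}|lebesgue. deriv f t) = f y - f 0"
proof -
  \<comment> \<open>Clamping the argument extends \<open>f\<close> by constants, which keeps it
    nondecreasing and 1-Lipschitz on the whole line.\<close>
  define h where "h t = f (max 0 (min 1 t))" for t
  have h: "0 \<le> h t - h s \<and> h t - h s \<le> t - s" if "s \<le> t" for s t
    using unit_shortD[OF f, of "max 0 (min 1 s)" "max 0 (min 1 t)"] that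
    by (auto simp: h_def max_def min_def split: if_splits)
  obtain g where g: "g \<in> borel_measurable borel" "\<And>x. 0 \<le> g x"
    "\<And>a b. a \<le> b \<Longrightarrow> (g has_integral (h b - h a)) {a..b}"
    using short_map_density[of h] h by blast
  have hf: "h t = f t" if "0 \<le> t" "t \<le> 1" for t using that by (simp add: h_def)
  have gy: "(g has_integral (f y - f 0)) {0..y}" if "0 \<le> y" "y \<le> 1" for y
    using g(3)[of 0 y] that by (simp add: hf)
  define N where "N = {x \<in> {0<..<1}. \<not> ((\<lambda>u. integral {0..u} g) has_real_derivative g x) (at x)}"
  have "negligible N"
    unfolding N_def using gy[of 1] by (intro lebesgue_differentiation_real) auto
  then have ae: "AE t in lebesgue. t \<notin> N"
    by (intro AE_not_in) (simp add: negligible_iff_null_sets)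
  have fg: "(f has_real_derivative g t) (at t)" if "t \<in> {0<..<1}" "t \<notin> N" for t
  proof -
    have "((\<lambda>u. integral {0..u} g) has_real_derivative g t) (at t)"
      using that by (auto simp: N_def)
    then have "((\<lambda>u. integral {0..u} g + f 0) has_real_derivative (g t + 0)) (at t)"
      by (intro DERIV_add DERIV_const)
    then have "((\<lambda>u. integral {0..u} g + f 0) has_real_derivative g t) (at t)" by simp
    then show ?thesis
      using that(1) by (rule has_derivative_cong_on_unit) (use integral_unique[OF gy] in simp)
  qed
  have dg: "deriv f t = g t" if "t \<in> {0<..<1}" "t \<notin> N" for t
    using fg[OF that] by (rule DERIV_imp_deriv)
  show "AE t in lebesgue. t \<in> {0<..<1} \<longrightarrow> (f has_real_derivative deriv f t) (at t)"
    using ae by eventually_elim (use fg dg in auto)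
  have "AE t in lebesgue. t \<in> {0<..<1} \<longrightarrow> deriv f t = g t"
    using ae by eventually_elim (use dg in auto)
  then have ae': "AE t in lebesgue. t \<in> {0..1} \<longrightarrow> deriv f t = g t"
    by (rule AE_lebesgue_interior_unit)
  fix y :: real assume y: "0 \<le> y" "y \<le> 1"
  have ae'': "AE t in lebesgue. t \<in> {0..y} \<longrightarrow> deriv f t = g t"
    using ae' by eventually_elim (use y in auto)
  \<comment> \<open>For the nonnegative \<open>g\<close>, Henstock-Kurzweil integrability implies
    Lebesgue integrability.\<close>
  have gi: "set_integrable lebesgue {0..y} g"
    using gy[OF y] g(2) by (intro nonnegative_absolutely_integrable_1) auto
  show "set_integrable lebesgue {0..y} (deriv f)"
    using set_lebesgue_integral_spike(1)[OF gi ae''] .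
  show "(LINT t:{0..y}|lebesgue. deriv f t) = f y - f 0"
    using set_lebesgue_integral_spike(2)[OF gi ae''] gy[OF y]
    by (simp add: set_lebesgue_integral_eq_integral(2)[OF gi] integral_unique)
qed

text \<open>The derivatives are nonnegative almost everywhere and integrate to increments tending to
  0, so their infimum over \<open>n\<close> has integral 0 and vanishes almost everywhere. This
  yields a suitable \<open>n\<close> for each \<open>t\<close> without any pointwise
  convergence.\<close>

lemma unit_short_AE_small_derivative:
  assumes p: "\<And>n :: nat. unit_short (p n)" and lim: "(\<lambda>n. p n 1 - p n 0) \<longlonglongrightarrow> 0"
  shows "AE t in lebesgue. t \<in> {0<..<1} \<longrightarrow> (\<forall>\<epsilon>>0. \<exists>n. deriv (p n) t < \<epsilon>)"
proof -
  define w where "w n t = ennreal (indicator {0..1} t * deriv (p n) t)" for n t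
  have int: "integrable lebesgue (\<lambda>t. indicator {0..1} t * deriv (p n) t)" for n
    using unit_short_deriv_integrable[OF p, of 1 n] by (simp add: set_integrable_def)
  have [measurable]: "w n \<in> borel_measurable lebesgue" for n
    using borel_measurable_integrable[OF int[of n]] unfolding w_def by measurable
  have wn: "(\<integral>\<^sup>+t. w n t \<partial>lebesgue) = ennreal (p n 1 - p n 0)" for n
  proof -
    have "AE t in lebesgue. t \<in> {0..1} \<longrightarrow> 0 \<le> deriv (p n) t"
      using unit_short_AE_differentiable[OF p[of n]]
      by (intro AE_lebesgue_interior_unit, eventually_elim)
        (use unit_short_derivative_bounds[OF p[of n]] in auto)
    then have "AE t in lebesgue. 0 \<le> indicator {0..1} t * deriv (p n) t"
      by eventually_elim (auto simp: indicator_def)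
    then have "(\<integral>\<^sup>+t. w n t \<partial>lebesgue) = ennreal (LINT t|lebesgue. indicator {0..1} t * deriv (p n) t)"
      unfolding w_def by (intro nn_integral_eq_integral int)
    also have "(LINT t|lebesgue. indicator {0..1} t * deriv (p n) t) = p n 1 - p n 0"
      using unit_short_integral_deriv[OF p, of 1 n] by (simp add: set_lebesgue_integral_def)
    finally show ?thesis .
  qed
  have "(\<integral>\<^sup>+t. (INF n. w n t) \<partial>lebesgue) \<le> ennreal (p n 1 - p n 0)" for n
    unfolding wn[symmetric] by (intro nn_integral_mono INF_lower) auto
  moreover have "(\<lambda>n. ennreal (p n 1 - p n 0)) \<longlonglongrightarrow> ennreal 0"
    using lim by (rule tendsto_ennrealI)
  ultimately have "(\<integral>\<^sup>+t. (INF n. w n t) \<partial>lebesgue) \<le> ennreal 0"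
    by (intro LIMSEQ_le_const) auto
  then have "AE t in lebesgue. (INF n. w n t) = 0"
    by (subst nn_integral_0_iff_AE[symmetric]) auto
  then show ?thesis
  proof eventually_elim
    case (elim t)
    show ?case
    proof (intro impI allI)
      fix \<epsilon> :: real assume t: "t \<in> {0<..<1}" and "0 < \<epsilon>"
      then have "(INF n. w n t) < ennreal \<epsilon>" using elim by simp
      then obtain n where "w n t < ennreal \<epsilon>" by (auto simp: INF_less_iff)
      then have "\<not> \<epsilon> \<le> deriv (p n) t"
        using t ennreal_leI[of \<epsilon> "deriv (p n) t"] by (auto simp: w_def)
      then show "\<exists>n. deriv (p n) t < \<epsilon>" by (auto simp: not_le)
    qed
  qed
qed

subsection \<open>Sklar's theorem for partially defined distribution functions\<close>

text \<open>The operator \<open>ext\<close> turns a function of the level \<open>F x\<close>, given on the range of \<open>F\<close>, into a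
  function on the unit interval: one-sided limits at the edges of a gap, linear interpolation across
  it (when the edges coincide, the quotient is 0). Being additive and monotone, it preserves
  2-increasingness when applied to one variable at a time.\<close>

locale unit_valued =
  fixes F :: "'a \<Rightarrow> real" and D :: "'a set" and p q :: 'a
  assumes p: "p \<in> D" "F p = 0" and q: "q \<in> D" "F q = 1"
    and range: "\<And>x. x \<in> D \<Longrightarrow> F x \<in> {0..1}"
begin

text \<open>Comparing levels \<open>F x\<close> instead of points forces \<open>h\<close> to be
  constant where \<open>F\<close> is constant, so \<open>h\<close> is a nondecreasing function of
  the level.\<close>

definition isotone :: "('a \<Rightarrow> real) \<Rightarrow> bool" where
  "isotone h \<longleftrightarrow> (\<forall>x\<in>D. \<forall>y\<in>D. F x \<le> F y \<longrightarrow> h x \<le> h y)"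

text \<open>\<open>lower F a\<close> and \<open>upper F a\<close> are the edges of the gap in the
  range of \<open>F\<close> at \<open>a\<close>. The points \<open>p\<close> and \<open>q\<close>,
  at levels 0 and 1, make the index sets nonempty for \<open>a\<close> in the unit interval and
  bound isotone functions.\<close>

definition lower :: "('a \<Rightarrow> real) \<Rightarrow> real \<Rightarrow> real" where
  "lower h a = (SUP x\<in>{x\<in>D. F x \<le> a}. h x)"

definition upper :: "('a \<Rightarrow> real) \<Rightarrow> real \<Rightarrow> real" where
  "upper h a = (INF x\<in>{x\<in>D. a \<le> F x}. h x)"

definition ext :: "('a \<Rightarrow> real) \<Rightarrow> real \<Rightarrow> real" where
  "ext h a = lower h a + (a - lower F a) / (upper F a - lower F a) * (upper h a - lower h a)"

lemma isotoneD: "isotone h \<Longrightarrow> x \<in> D \<Longrightarrow> y \<in> D \<Longrightarrow> F x \<le> F y \<Longrightarrow> h x \<le> h y"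
  by (auto simp: isotone_def)

lemma isotone_self: "isotone F"
  by (simp add: isotone_def)

lemma lower_ge:
  assumes "isotone h" "x \<in> D" "F x \<le> a"
  shows "h x \<le> lower h a"
  unfolding lower_def
proof (rule cSUP_upper)
  show "bdd_above (h ` {x \<in> D. F x \<le> a})"
    using assms(1) q range by (intro bdd_aboveI[of _ "h q"]) (auto intro: isotoneD)
qed (use assms in auto)

lemma lower_le:
  assumes "0 \<le> a" "\<And>x. x \<in> D \<Longrightarrow> F x \<le> a \<Longrightarrow> h x \<le> c"
  shows "lower h a \<le> c"
  unfolding lower_def using assms p by (intro cSUP_least) auto

lemma upper_le:
  assumes "isotone h" "x \<in> D" "a \<le> F x"
  shows "upper h a \<le> h x"
  unfolding upper_def
proof (rule cINF_lower)
  show "bdd_below (h ` {x \<in> D. a \<le> F x})"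
    using assms(1) p range by (intro bdd_belowI[of _ "h p"]) (auto intro: isotoneD)
qed (use assms in auto)

lemma upper_ge:
  assumes "a \<le> 1" "\<And>x. x \<in> D \<Longrightarrow> a \<le> F x \<Longrightarrow> c \<le> h x"
  shows "c \<le> upper h a"
  unfolding upper_def using assms q by (intro cINF_greatest) auto

lemma lower_le_upper: "isotone h \<Longrightarrow> 0 \<le> a \<Longrightarrow> a \<le> 1 \<Longrightarrow> lower h a \<le> upper h a"
  by (intro lower_le upper_ge) (auto intro: isotoneD order_trans)

lemma lower_self: "0 \<le> a \<Longrightarrow> lower F a \<le> a"
  by (intro lower_le) auto

lemma upper_self: "a \<le> 1 \<Longrightarrow> a \<le> upper F a"
  by (intro upper_ge) auto

lemma isotone_add: "isotone h \<Longrightarrow> isotone k \<Longrightarrow> isotone (\<lambda>x. h x + k x)"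
  by (auto simp: isotone_def intro: add_mono)

text \<open>Levels are totally ordered: of two points at levels at most \<open>a\<close>, the one at
  the higher level makes both isotone functions at least as large, so the two suprema are approached
  simultaneously.\<close>

lemma lower_add:
  assumes h: "isotone h" and k: "isotone k" and a: "0 \<le> a"
  shows "lower (\<lambda>x. h x + k x) a = lower h a + lower k a"
proof (rule antisym)
  show "lower (\<lambda>x. h x + k x) a \<le> lower h a + lower k a"
    using assms by (intro lower_le add_mono lower_ge)
  have "h x + k y \<le> lower (\<lambda>x. h x + k x) a"
    if "x \<in> D" "F x \<le> a" "y \<in> D" "F y \<le> a" for x y
  proof (cases "F x \<le> F y")
    case True
    with that h isotoneD[of h x y] show ?thesis
      using lower_ge[OF isotone_add[OF h k], of y a] by auto
  next
    case False
    with that k isotoneD[of k y x] show ?thesis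
      using lower_ge[OF isotone_add[OF h k], of x a] by auto
  qed
  then have "lower k a \<le> lower (\<lambda>x. h x + k x) a - h x" if "x \<in> D" "F x \<le> a" for x
    using that a by (intro lower_le) (auto simp: algebra_simps)
  then have "lower h a \<le> lower (\<lambda>x. h x + k x) a - lower k a"
    using a by (intro lower_le) (auto simp: algebra_simps)
  then show "lower h a + lower k a \<le> lower (\<lambda>x. h x + k x) a" by simp
qed

lemma upper_add:
  assumes h: "isotone h" and k: "isotone k" and a: "a \<le> 1"
  shows "upper (\<lambda>x. h x + k x) a = upper h a + upper k a"
proof (rule antisym)
  show "upper h a + upper k a \<le> upper (\<lambda>x. h x + k x) a"
    using assms by (intro upper_ge add_mono upper_le)
  have "upper (\<lambda>x. h x + k x) a \<le> h x + k y"
    if "x \<in> D" "a \<le> F x" "y \<in> D" "a \<le> F y" for x y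
  proof (cases "F x \<le> F y")
    case True
    with that k isotoneD[of k x y] show ?thesis
      using upper_le[OF isotone_add[OF h k], of x a] by auto
  next
    case False
    with that h isotoneD[of h y x] show ?thesis
      using upper_le[OF isotone_add[OF h k], of y a] by auto
  qed
  then have "upper (\<lambda>x. h x + k x) a - h x \<le> upper k a" if "x \<in> D" "a \<le> F x" for x
    using that a by (intro upper_ge) (auto simp: algebra_simps)
  then have "upper (\<lambda>x. h x + k x) a - upper k a \<le> upper h a"
    using a by (intro upper_ge) (auto simp: algebra_simps)
  then show "upper (\<lambda>x. h x + k x) a \<le> upper h a + upper k a" by simp
qed

text \<open>The interpolation weight depends on \<open>F\<close> and \<open>a\<close> only, so
  \<open>ext\<close> is linear in the edge values.\<close>

lemma ext_add:
  assumes "isotone h" "isotone k" "a \<in> {0..1}"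
  shows "ext (\<lambda>x. h x + k x) a = ext h a + ext k a"
proof -
  have "l + l' + c * (u + u' - (l + l')) = (l + c * (u - l)) + (l' + c * (u' - l'))" for c l l' u u' :: real
    by (simp add: algebra_simps)
  with assms show ?thesis
    unfolding ext_def by (simp add: lower_add upper_add)
qed

lemma ext_cong: "(\<And>x. x \<in> D \<Longrightarrow> h x = k x) \<Longrightarrow> ext h a = ext k a"
  by (simp add: ext_def lower_def upper_def cong: image_cong_simp)

text \<open>Additivity is available for isotone summands, hence the splitting of \<open>k\<close>
  into \<open>h\<close> and \<open>k - h\<close>.\<close>

lemma ext_diff:
  assumes "isotone h" "isotone (\<lambda>x. k x - h x)" "a \<in> {0..1}"
  shows "ext (\<lambda>x. k x - h x) a = ext k a - ext h a"
  using ext_add[OF assms] by simp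

lemma ext_bounds:
  assumes "isotone h" "a \<in> {0..1}"
  shows "lower h a \<le> ext h a" "ext h a \<le> upper h a"
proof -
  define \<theta> where "\<theta> = (a - lower F a) / (upper F a - lower F a)"
  have \<theta>: "0 \<le> \<theta>" "\<theta> \<le> 1"
    using assms lower_self[of a] upper_self[of a] by (auto simp: \<theta>_def divide_le_eq_1)
  have d: "0 \<le> upper h a - lower h a"
    using lower_le_upper[of h a] assms by simp
  have e: "ext h a = lower h a + \<theta> * (upper h a - lower h a)"
    by (simp add: ext_def \<theta>_def)
  show "lower h a \<le> ext h a" using \<theta> d by (simp add: e)
  show "ext h a \<le> upper h a" using \<theta> d mult_left_le_one_le[OF d \<theta>] by (simp add: e)
qed

text \<open>A level between \<open>a\<close> and \<open>b\<close> separates the two values. Without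
  one, \<open>a\<close> and \<open>b\<close> lie in the same gap and differ only in the
  interpolation weight.\<close>

lemma ext_mono:
  assumes h: "isotone h" and ab: "0 \<le> a" "a \<le> b" "b \<le> 1"
  shows "ext h a \<le> ext h b"
proof (cases "\<exists>x\<in>D. a \<le> F x \<and> F x \<le> b")
  case True
  then obtain x where x: "x \<in> D" "a \<le> F x" "F x \<le> b" by blast
  have "ext h a \<le> upper h a" using ext_bounds(2)[OF h] ab by simp
  also have "\<dots> \<le> h x" using upper_le[OF h] x by simp
  also have "\<dots> \<le> lower h b" using lower_ge[OF h] x by simp
  also have "\<dots> \<le> ext h b" using ext_bounds(1)[OF h] ab by simp
  finally show ?thesis .
next
  case False
  then have "{x \<in> D. F x \<le> a} = {x \<in> D. F x \<le> b}" "{x \<in> D. a \<le> F x} = {x \<in> D. b \<le> F x}"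
    using ab by force+
  then have eq: "lower k a = lower k b" "upper k a = upper k b" for k
    by (simp_all add: lower_def upper_def)
  have "(a - lower F b) / (upper F b - lower F b) \<le> (b - lower F b) / (upper F b - lower F b)"
    using lower_le_upper[OF isotone_self, of b] ab by (intro divide_right_mono) auto
  moreover have "0 \<le> upper h b - lower h b"
    using lower_le_upper[OF h, of b] ab by simp
  ultimately show ?thesis
    unfolding ext_def eq by (intro add_left_mono mult_right_mono)
qed

text \<open>At an attained level both edge values are squeezed to \<open>h x\<close>.\<close>

lemma ext_eq:
  assumes h: "isotone h" and x: "x \<in> D"
  shows "ext h (F x) = h x"
proof -
  have "h x \<le> lower h (F x)" "upper h (F x) \<le> h x"
    using lower_ge[OF h x] upper_le[OF h x] by auto
  then show ?thesis
    using ext_bounds[OF h, of "F x"] range[OF x] by auto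
qed

lemma ext_self:
  assumes "a \<in> {0..1}"
  shows "ext F a = a"
  using lower_self[of a] upper_self[of a] assms
  by (cases "upper F a = lower F a") (auto simp: ext_def)

end

section \<open>Extension of a two-variable distribution function to a copula\<close>

text \<open>The extension is made one variable at a time: \<open>S\<close> extends in the first
  variable for \<open>z\<close> in \<open>D\<close>, and \<open>C\<close> then extends
  \<open>S a\<close> in the second. Additivity and monotonicity of \<open>ext\<close>, applied to
  increments in the other variable, keep the rectangle inequality at each stage.\<close>

theorem sklar_extension:
  fixes H :: "real \<Rightarrow> real \<Rightarrow> real"
  assumes D: "0 \<in> D" "1 \<in> D" "D \<subseteq> {0..1}"
    and grounded: "\<And>u. u \<in> D \<Longrightarrow> H u 0 = 0 \<and> H 0 u = 0"
    and H11: "H 1 1 = 1"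
    and incr: "\<And>x x' z z'. \<lbrakk>x \<in> D; x' \<in> D; z \<in> D; z' \<in> D; x \<le> x'; z \<le> z'\<rbrakk>
        \<Longrightarrow> 0 \<le> H x' z' - H x' z - H x z' + H x z"
  obtains C where "copula2 C" "\<And>x z. x \<in> D \<Longrightarrow> z \<in> D \<Longrightarrow> C (H x 1) (H 1 z) = H x z"
proof -
  define F where "F x = H x 1" for x
  define G where "G z = H 1 z" for z
  have mono1: "H x z \<le> H x' z" if "x \<in> D" "x' \<in> D" "z \<in> D" "x \<le> x'" for x x' z
    using incr[of x x' 0 z] that grounded D by force
  have mono2: "H x z \<le> H x z'" if "x \<in> D" "z \<in> D" "z' \<in> D" "z \<le> z'" for x z z'
    using incr[of 0 x z z'] that grounded D by force
  have incr1: "H x' z - H x z \<le> F x' - F x" if "x \<in> D" "x' \<in> D" "z \<in> D" "x \<le> x'" for x x' z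
    using incr[of x x' z 1] that D by (auto simp: F_def)
  have incr2: "H x z' - H x z \<le> G z' - G z" if "x \<in> D" "z' \<in> D" "z \<in> D" "z \<le> z'" for x z z'
    using incr[of x 1 z z'] that D by (auto simp: G_def)
  \<comment> \<open>Equal margins leave no mass in the strip between \<open>x\<close> and
    \<open>x'\<close>, so \<open>H\<close> depends on \<open>x\<close> only through
    \<open>F x\<close>.\<close>
  have eq1: "H x z = H x' z" if "x \<in> D" "x' \<in> D" "z \<in> D" "F x = F x'" for x x' z
    using mono1[of x x' z] mono1[of x' x z] incr1[of x x' z] incr1[of x' x z] that by linarith
  have eq2: "H x z = H x z'" if "x \<in> D" "z' \<in> D" "z \<in> D" "G z = G z'" for x z z'
    using mono2[of x z z'] mono2[of x z' z] incr2[of x z z'] incr2[of x z' z] that by linarith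
  have F: "F 0 = 0" "F 1 = 1" "x \<in> D \<Longrightarrow> F x \<in> {0..1}" for x
    using grounded H11 mono1[of 0 x 1] mono1[of x 1 1] D by (auto simp: F_def)
  have G: "G 0 = 0" "G 1 = 1" "x \<in> D \<Longrightarrow> G x \<in> {0..1}" for x
    using grounded H11 mono2[of 1 0 x] mono2[of 1 x 1] D by (auto simp: G_def)
  interpret F: unit_valued F D 0 1 by unfold_locales (use D F in auto)
  interpret G: unit_valued G D 0 1 by unfold_locales (use D G in auto)
  have isoF: "F.isotone (\<lambda>x. H x z)" if "z \<in> D" for z
    unfolding F.isotone_def
  proof (intro ballI impI)
    fix x y assume "x \<in> D" "y \<in> D" "F x \<le> F y"
    then show "H x z \<le> H y z"
      using mono1[of x y z] mono1[of y x 1] eq1[of x y z] that D(2)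
      by (cases "x \<le> y") (auto simp: F_def)
  qed
  \<comment> \<open>Increments over a \<open>z\<close>-strip must be isotone too, since
    \<open>ext_diff\<close> and \<open>ext_mono\<close> are applied to them.\<close>
  have isoFd: "F.isotone (\<lambda>x. H x z' - H x z)" if "z \<in> D" "z' \<in> D" "z \<le> z'" for z z'
    unfolding F.isotone_def
  proof (intro ballI impI)
    fix x y assume "x \<in> D" "y \<in> D" "F x \<le> F y"
    then show "H x z' - H x z \<le> H y z' - H y z"
      using incr[of x y z z'] mono1[of y x 1] eq1[of x y z] eq1[of x y z'] that D(2)
      by (cases "x \<le> y") (auto simp: F_def)
  qed
  define S where "S a z = F.ext (\<lambda>x. H x z) a" for a z
  have Sdiff: "S a z' - S a z = F.ext (\<lambda>x. H x z' - H x z) a"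
    if "z \<in> D" "z' \<in> D" "z \<le> z'" "a \<in> {0..1}" for a z z'
    unfolding S_def using that by (intro F.ext_diff[symmetric] isoF isoFd)
  have S: "S a z' - S a z \<le> S a' z' - S a' z"
    if "z \<in> D" "z' \<in> D" "z \<le> z'" "0 \<le> a" "a \<le> a'" "a' \<le> 1" for a a' z z'
    using F.ext_mono[OF isoFd] that by (simp add: Sdiff)
  have SF: "S (F x) z = H x z" if "x \<in> D" "z \<in> D" for x z
    unfolding S_def using that by (intro F.ext_eq isoF)
  have S0: "S 0 z = 0" and S1: "S 1 z = G z" if "z \<in> D" for z
    using SF[of 0 z] SF[of 1 z] that D grounded F by (auto simp: G_def)
  have Seq: "S a z = S a z'" if "z \<in> D" "z' \<in> D" "G z = G z'" for a z z'
    unfolding S_def using that by (intro F.ext_cong) (auto intro: eq2)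
  have Sa0: "S a 0 = 0" and Sa1: "S a 1 = a" if "a \<in> {0..1}" for a
  proof -
    \<comment> \<open>Additivity gives \<open>e = e + e\<close> for the extension \<open>e\<close>
      of the zero function.\<close>
    have "F.ext (\<lambda>x. 0 + 0) a = F.ext (\<lambda>x. 0) a + F.ext (\<lambda>x. 0) a"
      using that by (intro F.ext_add) (auto simp: F.isotone_def)
    moreover have "S a 0 = F.ext (\<lambda>x. 0) a"
      unfolding S_def by (intro F.ext_cong) (auto simp: grounded)
    ultimately show "S a 0 = 0" by simp
    show "S a 1 = a"
      using F.ext_self[OF that] by (simp add: S_def F_def[abs_def])
  qed
  have isoG: "G.isotone (S a')" if "a' \<in> {0..1}" for a'
    unfolding G.isotone_def
  proof (intro ballI impI)
    fix z y assume zy: "z \<in> D" "y \<in> D" "G z \<le> G y"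
    show "S a' z \<le> S a' y"
    proof (cases "z \<le> y")
      case True then show ?thesis using S[of z y 0 a'] S0 zy that by auto
    next
      case False then show ?thesis using Seq[of z y a'] mono2[of 1 y z] zy D by (auto simp: G_def)
    qed
  qed
  have isoGd: "G.isotone (\<lambda>z. S a' z - S a z)" if "0 \<le> a" "a \<le> a'" "a' \<le> 1" for a a'
    unfolding G.isotone_def
  proof (intro ballI impI)
    fix z y assume zy: "z \<in> D" "y \<in> D" "G z \<le> G y"
    show "S a' z - S a z \<le> S a' y - S a y"
    proof (cases "z \<le> y")
      case True then show ?thesis using S[of z y a a'] zy that by auto
    next
      case False then show ?thesis using Seq[of z y] mono2[of 1 y z] zy D by (auto simp: G_def)
    qed
  qed
  define C where "C a b = G.ext (S a) b" for a b
  have CG: "C a (G z) = S a z" if "a \<in> {0..1}" "z \<in> D" for a z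
    unfolding C_def using that by (intro G.ext_eq isoG)
  show thesis
  proof
    show "C (H x 1) (H 1 z) = H x z" if "x \<in> D" "z \<in> D" for x z
      using CG[of "F x" z] SF[of x z] F that by (simp add: F_def G_def)
    show "copula2 C"
      unfolding copula2_def
    proof (intro conjI ballI impI)
      fix u :: real assume u: "u \<in> {0..1}"
      show "C u 0 = 0" "C u 1 = u"
        using CG[of u 0] CG[of u 1] G D Sa0 Sa1 u by auto
      have "C 0 u = G.ext (\<lambda>z. S 0 z) u" "C 0 u = G.ext (\<lambda>z. S 0 z + S 0 z) u"
        unfolding C_def by (auto intro!: G.ext_cong simp: S0)
      then show "C 0 u = 0"
        using G.ext_add[OF isoG isoG u, of 0 0] by simp
      have "C 1 u = G.ext G u"
        unfolding C_def by (intro G.ext_cong) (simp add: S1)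
      then show "C 1 u = u" using G.ext_self[OF u] by simp
    next
      fix u1 u2 v1 v2 :: real
      assume a: "u1 \<in> {0..1}" "u2 \<in> {0..1}" "v1 \<in> {0..1}" "v2 \<in> {0..1}" "u1 \<le> u2" "v1 \<le> v2"
      have "C u2 v - C u1 v = G.ext (\<lambda>z. S u2 z - S u1 z) v" if "v \<in> {0..1}" for v
        unfolding C_def using a that by (intro G.ext_diff[symmetric] isoG isoGd) auto
      then have "C u2 v1 - C u1 v1 \<le> C u2 v2 - C u1 v2"
        using G.ext_mono[OF isoGd] a by simp
      then show "0 \<le> C u2 v2 - C u2 v1 - C u1 v2 + C u1 v1" by simp
    qed
  qed
qed

subsection \<open>Star products of copulas\<close>

lemma copula2_swap: "copula2 C \<Longrightarrow> copula2 (\<lambda>u v. C v u)"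
  unfolding copula2_def by (auto simp: algebra_simps)

lemma copula2_boundary:
  assumes "copula2 C" "u \<in> {0..1}"
  shows "C u 0 = 0" "C 0 u = 0" "C u 1 = u" "C 1 u = u"
  using assms by (auto simp: copula2_def)

lemma copula2_increasing:
  "copula2 C \<Longrightarrow> 0 \<le> u \<Longrightarrow> u \<le> u' \<Longrightarrow> u' \<le> 1 \<Longrightarrow> 0 \<le> v \<Longrightarrow> v \<le> v' \<Longrightarrow> v' \<le> 1 \<Longrightarrow>
    C u' v - C u v \<le> C u' v' - C u v'"
  unfolding copula2_def by (smt (verit) atLeastAtMost_iff)

text \<open>The increment over \<open>[s, t]\<close> is the mass of \<open>[0, u] x [s, t]\<close>,
  which is nonnegative and at most the mass \<open>t - s\<close> of the full strip.\<close>

lemma copula2_section_right: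
  assumes "copula2 C" "u \<in> {0..1}"
  shows "unit_short (C u)"
  unfolding unit_short_def
proof (intro allI impI)
  fix s t :: real assume st: "0 \<le> s" "s \<le> t" "t \<le> 1"
  show "0 \<le> C u t - C u s \<and> C u t - C u s \<le> t - s"
    using copula2_increasing[OF assms(1), of 0 u s t] copula2_increasing[OF assms(1), of u 1 s t]
      copula2_boundary[OF assms(1), of s] copula2_boundary[OF assms(1), of t] assms(2) st by simp
qed

lemma copula2_section_left: "copula2 C \<Longrightarrow> u \<in> {0..1} \<Longrightarrow> unit_short (\<lambda>s. C s u)"
  using copula2_section_right[OF copula2_swap] .

lemma copula2_lipschitz:
  assumes C: "copula2 C" and "u \<in> {0..1}" "u' \<in> {0..1}" "v \<in> {0..1}" "v' \<in> {0..1}"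
  shows "\<bar>C u' v' - C u v\<bar> \<le> \<bar>u' - u\<bar> + \<bar>v' - v\<bar>"
proof -
  have "\<bar>f t - f s\<bar> \<le> \<bar>t - s\<bar>" if "unit_short f" "s \<in> {0..1}" "t \<in> {0..1}" for f :: "real \<Rightarrow> real" and s t
    using unit_shortD[OF that(1), of s t] unit_shortD[OF that(1), of t s] that(2,3)
    by (cases "s \<le> t") auto
  from this[OF copula2_section_left[OF C], of v' u u'] this[OF copula2_section_right[OF C], of u v v']
  show ?thesis using assms by linarith
qed

text \<open>The independence copula serves as the default member of a family at exceptional
  parameters \<open>t\<close>.\<close>

lemma copula2_product: "copula2 (\<lambda>u v. u * v)"
  unfolding copula2_def
proof (intro conjI ballI impI)
  fix u1 u2 v1 v2 :: real assume "u1 \<le> u2" "v1 \<le> v2"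
  then have "0 \<le> (u2 - u1) * (v2 - v1)" by simp
  then show "0 \<le> u2 * v2 - u2 * v1 - u1 * v2 + u1 * v1" by (simp add: algebra_simps)
qed auto

section \<open>Evaluation of star products and their marginals\<close>

text \<open>By \<open>g 0 = 0\<close> the integral of \<open>deriv g\<close> up to \<open>y\<close>
  is \<open>g y\<close>, so only the almost everywhere identity of the integrands has to be
  checked.\<close>

lemma star_eqI:
  assumes g: "unit_short g" "g 0 = 0" and y: "y \<in> {0..1}"
    and ae: "AE t in lebesgue. t \<in> {0<..<1} \<longrightarrow>
      Cf t (deriv (\<lambda>s. A x s) t) (deriv (\<lambda>s. B s z) t) = deriv g t"
  shows "star A Cf B x y z = g y"
proof -
  have "AE t in lebesgue. t \<in> {0..y} \<longrightarrow>
      Cf t (deriv (\<lambda>s. A x s) t) (deriv (\<lambda>s. B s z) t) = deriv g t"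
    using AE_lebesgue_interior_unit[OF ae] by eventually_elim (use y in auto)
  then have "star A Cf B x y z = (LINT t:{0..y}|lebesgue. deriv g t)"
    unfolding star_def using y
    by (intro set_lebesgue_integral_spike(2) unit_short_deriv_integrable[OF g(1)]) auto
  also have "\<dots> = g y"
    using unit_short_integral_deriv[OF g(1), of y] g(2) y by simp
  finally show ?thesis .
qed

text \<open>On the unit interval \<open>B s 1\<close> is \<open>s\<close>, with derivative 1, and
  \<open>Cf t u 1 = u\<close>. The latter is known only for \<open>u\<close> in the unit interval,
  hence the derivative bound in the proof.\<close>

lemma star_one_right:
  assumes C: "\<And>t. t \<in> {0..1} \<Longrightarrow> copula2 (Cf t)" and A: "copula2 A" and B: "copula2 B"
    and x: "x \<in> {0..1}" and y: "y \<in> {0..1}"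
  shows "star A Cf B x y 1 = A x y"
proof (rule star_eqI)
  show sx: "unit_short (A x)" using A x by (rule copula2_section_right)
  show "A x 0 = 0" using A x by (rule copula2_boundary)
  show "AE t in lebesgue. t \<in> {0<..<1} \<longrightarrow>
      Cf t (deriv (A x) t) (deriv (\<lambda>s. B s 1) t) = deriv (A x) t"
    using unit_short_AE_differentiable[OF sx]
  proof eventually_elim
    case (elim t)
    show ?case
    proof
      assume t: "t \<in> {0<..<1}"
      have "deriv (\<lambda>s. B s 1) t = deriv (\<lambda>s. s) t"
        using t copula2_boundary[OF B] by (intro deriv_cong_on_unit)
      then have "deriv (\<lambda>s. B s 1) t = 1" by simp
      moreover have "deriv (A x) t \<in> {0..1}"
        using elim t unit_short_derivative_bounds[OF sx] by blast
      ultimately show "Cf t (deriv (A x) t) (deriv (\<lambda>s. B s 1) t) = deriv (A x) t"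
        using copula2_boundary(3)[OF C] t by simp
    qed
  qed
qed (rule y)

lemma star_one_left:
  assumes C: "\<And>t. t \<in> {0..1} \<Longrightarrow> copula2 (Cf t)" and A: "copula2 A" and B: "copula2 B"
    and z: "z \<in> {0..1}" and y: "y \<in> {0..1}"
  shows "star A Cf B 1 y z = B y z"
proof (rule star_eqI)
  show sz: "unit_short (\<lambda>s. B s z)" using B z by (rule copula2_section_left)
  show "B 0 z = 0" using B z by (rule copula2_boundary)
  show "AE t in lebesgue. t \<in> {0<..<1} \<longrightarrow>
      Cf t (deriv (A 1) t) (deriv (\<lambda>s. B s z) t) = deriv (\<lambda>s. B s z) t"
    using unit_short_AE_differentiable[OF sz]
  proof eventually_elim
    case (elim t)
    show ?case
    proof
      assume t: "t \<in> {0<..<1}"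
      have "deriv (A 1) t = deriv (\<lambda>s. s) t"
        using t copula2_boundary[OF A] by (intro deriv_cong_on_unit)
      then have "deriv (A 1) t = 1" by simp
      moreover have "deriv (\<lambda>s. B s z) t \<in> {0..1}"
        using elim t unit_short_derivative_bounds[OF sz] by blast
      ultimately show "Cf t (deriv (A 1) t) (deriv (\<lambda>s. B s z) t) = deriv (\<lambda>s. B s z) t"
        using copula2_boundary(4)[OF C] t by simp
    qed
  qed
qed (rule y)

section \<open>Slab masses and sections of 3-copulas\<close>

lemma copula3_boundary:
  assumes "copula3 K" "u \<in> {0..1}" "v \<in> {0..1}"
  shows "K 0 u v = 0" "K u 0 v = 0" "K u v 0 = 0"
  using assms by (auto simp: copula3_def)

lemma copula3_margin:
  assumes "copula3 K" "u \<in> {0..1}"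
  shows "K u 1 1 = u" "K 1 u 1 = u" "K 1 1 u = u"
  using assms by (auto simp: copula3_def)

lemma copula3_volume:
  assumes "copula3 K" "0 \<le> x" "x \<le> x'" "x' \<le> 1" "0 \<le> y" "y \<le> y'" "y' \<le> 1" "0 \<le> z" "z \<le> z'" "z' \<le> 1"
  shows "0 \<le> K x' y' z' - K x y' z' - K x' y z' - K x' y' z + K x y z' + K x y' z + K x' y z - K x y z"
proof -
  have "x \<in> {0..1}" "x' \<in> {0..1}" "y \<in> {0..1}" "y' \<in> {0..1}" "z \<in> {0..1}" "z' \<in> {0..1}"
    using assms by auto
  with assms(1) assms(3,6,9) show ?thesis unfolding copula3_def by blast
qed

text \<open>These permutations move the third or the first variable into the middle slot, over which
  \<open>copula3_star_representation\<close> integrates.\<close>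

lemma copula3_permute:
  assumes "copula3 K"
  shows "copula3 (\<lambda>x t z. K x z t)" "copula3 (\<lambda>x t z. K t x z)"
proof -
  show "copula3 (\<lambda>x t z. K x z t)"
    unfolding copula3_def
  proof (intro conjI ballI impI)
    fix a1 b1 a2 b2 a3 b3 :: real
    assume "a1 \<in> {0..1}" "b1 \<in> {0..1}" "a2 \<in> {0..1}" "b2 \<in> {0..1}" "a3 \<in> {0..1}" "b3 \<in> {0..1}"
      "a1 \<le> b1" "a2 \<le> b2" "a3 \<le> b3"
    then show "0 \<le> K b1 b3 b2 - K a1 b3 b2 - K b1 b3 a2 - K b1 a3 b2
          + K a1 b3 a2 + K a1 a3 b2 + K b1 a3 a2 - K a1 a3 a2"
      using copula3_volume[OF assms, of a1 b1 a3 b3 a2 b2] by simp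
  qed (use copula3_boundary[OF assms] copula3_margin[OF assms] in auto)
  show "copula3 (\<lambda>x t z. K t x z)"
    unfolding copula3_def
  proof (intro conjI ballI impI)
    fix a1 b1 a2 b2 a3 b3 :: real
    assume "a1 \<in> {0..1}" "b1 \<in> {0..1}" "a2 \<in> {0..1}" "b2 \<in> {0..1}" "a3 \<in> {0..1}" "b3 \<in> {0..1}"
      "a1 \<le> b1" "a2 \<le> b2" "a3 \<le> b3"
    then show "0 \<le> K b2 b1 b3 - K b2 a1 b3 - K a2 b1 b3 - K b2 b1 a3
          + K a2 a1 b3 + K b2 a1 a3 + K a2 b1 a3 - K a2 a1 a3"
      using copula3_volume[OF assms, of a2 b2 a1 b1 a3 b3] by simp
  qed (use copula3_boundary[OF assms] copula3_margin[OF assms] in auto)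
qed

text \<open>In terms of mass in the slab \<open>[s, t]\<close>, the first two facts are the
  nonnegative volume of one box, grouped by \<open>z\<close> and by \<open>x\<close>; the third
  compares two nested boxes anchored at 0.\<close>

lemma copula3_slab:
  assumes K: "copula3 K" and "0 \<le> x" "x \<le> x'" "x' \<le> 1" "0 \<le> s" "s \<le> t" "t \<le> 1"
    "0 \<le> z" "z \<le> z'" "z' \<le> 1"
  shows "(K x' t z - K x t z) - (K x' s z - K x s z) \<le> (K x' t z' - K x t z') - (K x' s z' - K x s z')"
    and "(K x t z' - K x t z) - (K x s z' - K x s z) \<le> (K x' t z' - K x' t z) - (K x' s z' - K x' s z)"
    and "K x t z - K x s z \<le> K x' t z' - K x' s z'"
proof -
  show "(K x' t z - K x t z) - (K x' s z - K x s z) \<le> (K x' t z' - K x t z') - (K x' s z' - K x s z')"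
    and "(K x t z' - K x t z) - (K x s z' - K x s z) \<le> (K x' t z' - K x' t z) - (K x' s z' - K x' s z)"
    using copula3_volume[of K x x' s t z z'] assms by linarith+
  have "K x t z - K x s z \<le> K x' t z - K x' s z"
    using copula3_volume[OF K, of x x' s t 0 z] copula3_boundary[OF K] assms by simp
  also have "\<dots> \<le> K x' t z' - K x' s z'"
    using copula3_volume[OF K, of 0 x' s t z z'] copula3_boundary[OF K] assms by simp
  finally show "K x t z - K x s z \<le> K x' t z' - K x' s z'" .
qed

text \<open>The increment is the mass of a box inside the slab \<open>[s, t]\<close>, whose total
  mass is \<open>t - s\<close>.\<close>

lemma copula3_section:
  assumes K: "copula3 K" and x: "x \<in> {0..1}" and z: "z \<in> {0..1}"
  shows "unit_short (\<lambda>s. K x s z)"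
  unfolding unit_short_def
proof (intro allI impI)
  fix s t :: real assume st: "0 \<le> s" "s \<le> t" "t \<le> 1"
  have "K 0 t 0 - K 0 s 0 \<le> K x t z - K x s z" "K x t z - K x s z \<le> K 1 t 1 - K 1 s 1"
    using copula3_slab(3)[OF K] x z st by auto
  then show "0 \<le> K x t z - K x s z \<and> K x t z - K x s z \<le> t - s"
    using copula3_boundary[OF K] copula3_margin[OF K] st by simp
qed

text \<open>The increment is the slab mass between two nested anchored rectangles; the upper bound
  comes from the larger rectangle alone.\<close>

lemma copula3_section_difference:
  assumes K: "copula3 K" and "0 \<le> x" "x \<le> x'" "x' \<le> 1" "0 \<le> z" "z \<le> z'" "z' \<le> 1"
  shows "unit_short (\<lambda>s. K x' s z' - K x s z)"
  unfolding unit_short_def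
proof (intro allI impI)
  fix s t :: real assume st: "0 \<le> s" "s \<le> t" "t \<le> 1"
  have "0 \<le> K x t z - K x s z" "K x' t z' - K x' s z' \<le> t - s"
    using copula3_section[OF K, of x z] copula3_section[OF K, of x' z'] st assms
    by (auto simp: unit_short_def)
  moreover have "K x t z - K x s z \<le> K x' t z' - K x' s z'"
    using copula3_slab(3)[OF K] assms st by auto
  ultimately show "0 \<le> (K x' t z' - K x t z) - (K x' s z' - K x s z) \<and>
      (K x' t z' - K x t z) - (K x' s z' - K x s z) \<le> t - s"
    by linarith
qed

section \<open>Representation of a 3-copula as a star product\<close>

text \<open>Probabilistically, for almost every \<open>t\<close>, \<open>H t\<close> is the
  conditional joint distribution function of the outer variables given the value \<open>t\<close> of
  the middle one, and \<open>Cf t\<close> is a copula for it.\<close>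

theorem copula3_star_representation:
  assumes K: "copula3 K"
    and A: "\<And>x t. x \<in> {0..1} \<Longrightarrow> t \<in> {0..1} \<Longrightarrow> A x t = K x t 1"
    and B: "\<And>t z. t \<in> {0..1} \<Longrightarrow> z \<in> {0..1} \<Longrightarrow> B t z = K 1 t z"
  obtains Cf where "\<And>t. copula2 (Cf t)"
    "\<And>x y z. x \<in> {0..1} \<Longrightarrow> y \<in> {0..1} \<Longrightarrow> z \<in> {0..1} \<Longrightarrow> K x y z = star A Cf B x y z"
proof -
  \<comment> \<open>Rational arguments are countably many, so one null set of \<open>t\<close>
    serves all of them.\<close>
  define D where "D = {x::real. x \<in> \<rat> \<and> 0 \<le> x \<and> x \<le> 1}"
  have D: "0 \<in> D" "1 \<in> D" "D \<subseteq> {0..1}" by (auto simp: D_def)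
  have cD: "countable D"
    by (rule countable_subset[OF _ countable_rat]) (auto simp: D_def)
  define H where "H t x z = deriv (\<lambda>s. K x s z) t" for t x z
  define good where "good t \<longleftrightarrow> t \<in> {0<..<1} \<and>
    (\<forall>x\<in>D. \<forall>z\<in>D. ((\<lambda>s. K x s z) has_real_derivative H t x z) (at t))" for t
  have "\<exists>C. copula2 C \<and> (\<forall>x\<in>D. \<forall>z\<in>D. C (H t x 1) (H t 1 z) = H t x z)" if "good t" for t
  proof -
    have t: "t \<in> {0<..<1}" using that by (simp add: good_def)
    have d: "((\<lambda>s. K x s z) has_real_derivative H t x z) (at t)" if "x \<in> D" "z \<in> D" for x z
      using that \<open>good t\<close> by (simp add: good_def)
    have const: "H t x z = 0" if "\<And>s. s \<in> {0..1} \<Longrightarrow> K x s z = 0" for x z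
      using deriv_cong_on_unit[OF t, of "\<lambda>s. K x s z" "\<lambda>s. 0"] that by (simp add: H_def)
    obtain C where "copula2 C" "\<And>x z. x \<in> D \<Longrightarrow> z \<in> D \<Longrightarrow> C (H t x 1) (H t 1 z) = H t x z"
    proof (rule sklar_extension[OF D, of "H t"])
      show "H t u 0 = 0 \<and> H t 0 u = 0" if "u \<in> D" for u
        using that D copula3_boundary[OF K, of u] copula3_boundary[OF K, of _ u] by (auto intro!: const)
      show "H t 1 1 = 1"
        using deriv_cong_on_unit[OF t, of "\<lambda>s. K 1 s 1" "\<lambda>s. s"] copula3_boundary[OF K] copula3_margin[OF K]
        by (simp add: H_def)
      fix x x' z z' assume xz: "x \<in> D" "x' \<in> D" "z \<in> D" "z' \<in> D" "x \<le> x'" "z \<le> z'"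
      \<comment> \<open>This combination is the mass of a box with middle side
        \<open>[0, s]\<close>, hence nondecreasing in \<open>s\<close>.\<close>
      have "((\<lambda>s. K x' s z' - K x' s z - K x s z' + K x s z) has_real_derivative
          (H t x' z' - H t x' z - H t x z' + H t x z)) (at t)"
        by (intro DERIV_add DERIV_diff d xz)
      then show "0 \<le> H t x' z' - H t x' z - H t x z' + H t x z"
      proof (rule derivative_nonneg_on_unit[rotated, OF _ t])
        fix s r :: real assume "0 \<le> s" "s \<le> r" "r \<le> 1"
        then show "K x' s z' - K x' s z - K x s z' + K x s z \<le> K x' r z' - K x' r z - K x r z' + K x r z"
          using copula3_slab(1)[OF K, of x x' s r z z'] xz by (auto simp: D_def)
      qed
    qed blast
    then show ?thesis by blast
  qed
  then obtain Cg where Cg: "\<And>t. good t \<Longrightarrow> copula2 (Cg t)"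
    "\<And>t x z. good t \<Longrightarrow> x \<in> D \<Longrightarrow> z \<in> D \<Longrightarrow> Cg t (H t x 1) (H t 1 z) = H t x z"
    by metis
  define Cf where "Cf t = (if good t then Cg t else (\<lambda>u v. u * v))" for t
  have AEgood: "AE t in lebesgue. t \<in> {0<..<1} \<longrightarrow> good t"
  proof -
    have "AE t in lebesgue. \<forall>x\<in>D. \<forall>z\<in>D. t \<in> {0<..<1} \<longrightarrow>
        ((\<lambda>s. K x s z) has_real_derivative H t x z) (at t)"
      unfolding H_def using D(3)
      by (intro AE_ball_countable' cD unit_short_AE_differentiable copula3_section[OF K]) auto
    then show ?thesis by eventually_elim (auto simp: good_def)
  qed
  show thesis
  proof
    show "copula2 (Cf t)" for t by (simp add: Cf_def Cg copula2_product)
    fix x y z :: real assume x: "x \<in> {0..1}" and y: "y \<in> {0..1}" and z: "z \<in> {0..1}"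
    \<comment> \<open>Approximation from above brings the differences
      \<open>K (p n) s 1 - K x s 1\<close> under \<open>copula3_section_difference\<close>; at
      \<open>u = 1\<close> only the constant sequence remains.\<close>
    have approx: "\<exists>r :: nat \<Rightarrow> real. (\<forall>n. r n \<in> D \<and> u \<le> r n) \<and> r \<longlonglongrightarrow> u" if u: "u \<in> {0..1}" for u
    proof (cases "u = 1")
      case True then show ?thesis using D by (intro exI[of _ "\<lambda>_. 1"]) auto
    next
      case False
      have "\<exists>q\<in>\<rat>. u < q \<and> q < min 1 (u + inverse (Suc n))" for n
        using False u by (intro Rats_dense_in_real) auto
      then obtain r where r: "\<And>n. r n \<in> \<rat>" "\<And>n. u < r n" "\<And>n. r n < min 1 (u + inverse (Suc n))"
        by metis
      have "r \<longlonglongrightarrow> u"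
      proof (rule tendsto_sandwich[of "\<lambda>_. u" r _ "\<lambda>n. u + inverse (real (Suc n))"])
        show "(\<lambda>n. u + inverse (real (Suc n))) \<longlonglongrightarrow> u"
          using tendsto_add[OF tendsto_const[of u] LIMSEQ_inverse_real_of_nat] by simp
        show "\<forall>\<^sub>F n in sequentially. u \<le> r n" "\<forall>\<^sub>F n in sequentially. r n \<le> u + inverse (real (Suc n))"
          using r by (auto intro!: always_eventually less_imp_le)
      qed simp
      moreover have "r n \<in> D \<and> u \<le> r n" for n
        using r(1)[of n] r(2)[of n] r(3)[of n] u by (simp add: D_def)
      ultimately show ?thesis by blast
    qed
    obtain p where p: "\<And>n :: nat. p n \<in> D" "\<And>n. x \<le> p n" "p \<longlonglongrightarrow> x" using approx[OF x] by blast
    obtain q where q: "\<And>n :: nat. q n \<in> D" "\<And>n. z \<le> q n" "q \<longlonglongrightarrow> z" using approx[OF z] by blast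
    note pD = subsetD[OF D(3) p(1)] and qD = subsetD[OF D(3) q(1)]
    \<comment> \<open>The increment of this difference over the unit interval is
      \<open>p n - x\<close>, which tends to 0.\<close>
    have "AE t in lebesgue. t \<in> {0<..<1} \<longrightarrow>
        (\<forall>\<epsilon>>0. \<exists>n. deriv (\<lambda>s. K (p n) s 1 - K x s 1) t < \<epsilon>)"
    proof (rule unit_short_AE_small_derivative)
      show "unit_short (\<lambda>s. K (p n) s 1 - K x s 1)" for n
        using p(2)[of n] pD[of n] x by (intro copula3_section_difference[OF K]) auto
      show "(\<lambda>n. (K (p n) 1 1 - K x 1 1) - (K (p n) 0 1 - K x 0 1)) \<longlonglongrightarrow> 0"
        using p(3) pD x copula3_boundary[OF K] copula3_margin[OF K] by (simp add: LIM_zero)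
    qed
    moreover have "AE t in lebesgue. t \<in> {0<..<1} \<longrightarrow>
        (\<forall>\<epsilon>>0. \<exists>n. deriv (\<lambda>s. K 1 s (q n) - K 1 s z) t < \<epsilon>)"
    proof (rule unit_short_AE_small_derivative)
      show "unit_short (\<lambda>s. K 1 s (q n) - K 1 s z)" for n
        using q(2)[of n] qD[of n] z by (intro copula3_section_difference[OF K]) auto
      show "(\<lambda>n. (K 1 1 (q n) - K 1 1 z) - (K 1 0 (q n) - K 1 0 z)) \<longlonglongrightarrow> 0"
        using q(3) qD z copula3_boundary[OF K] copula3_margin[OF K] by (simp add: LIM_zero)
    qed
    moreover have "AE t in lebesgue. t \<in> {0<..<1} \<longrightarrow>
        ((\<lambda>s. K x s z) has_real_derivative H t x z) (at t)"
      "AE t in lebesgue. t \<in> {0<..<1} \<longrightarrow> ((\<lambda>s. K x s 1) has_real_derivative H t x 1) (at t)"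
      "AE t in lebesgue. t \<in> {0<..<1} \<longrightarrow> ((\<lambda>s. K 1 s z) has_real_derivative H t 1 z) (at t)"
      unfolding H_def
      by (rule unit_short_AE_differentiable, rule copula3_section[OF K], (use x z in simp), (use x z in simp))+
    ultimately have "AE t in lebesgue. t \<in> {0<..<1} \<longrightarrow> Cf t (H t x 1) (H t 1 z) = H t x z"
      using AEgood
    proof eventually_elim
      case (elim t)
      show ?case
      proof
        assume t: "t \<in> {0<..<1}"
        note dxz = elim(3)[rule_format, OF t] and dx = elim(4)[rule_format, OF t]
          and dz = elim(5)[rule_format, OF t]
        have gt: "good t" using elim t by blast
        then have d: "((\<lambda>s. K x s z) has_real_derivative H t x z) (at t)" if "x \<in> D" "z \<in> D" for x z
          using that by (simp add: good_def)
        \<comment> \<open>Half of the bound comes from passing from \<open>H t x z\<close> to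
          \<open>H t (p n) (q m)\<close>, half from the Lipschitz estimate for \<open>Cf t\<close>;
          \<open>n\<close> and \<open>m\<close> are chosen independently.\<close>
        have "\<bar>Cf t (H t x 1) (H t 1 z) - H t x z\<bar> \<le> 4 * \<epsilon>" if \<epsilon>: "0 < \<epsilon>" for \<epsilon>
        proof -
          obtain n where n: "deriv (\<lambda>s. K (p n) s 1 - K x s 1) t < \<epsilon>" using elim(1) t \<epsilon> by blast
          obtain m where m: "deriv (\<lambda>s. K 1 s (q m) - K 1 s z) t < \<epsilon>" using elim(2) t \<epsilon> by blast
          have bx: "((\<lambda>s. K (p n) s 1 - K x s 1) has_real_derivative (H t (p n) 1 - H t x 1)) (at t)"
            by (intro DERIV_diff d dx p D)
          have bz: "((\<lambda>s. K 1 s (q m) - K 1 s z) has_real_derivative (H t 1 (q m) - H t 1 z)) (at t)"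
            by (intro DERIV_diff d dz q D)
          have bxz: "((\<lambda>s. K (p n) s (q m) - K x s z) has_real_derivative (H t (p n) (q m) - H t x z)) (at t)"
            by (intro DERIV_diff d dxz p q)
          have fx: "H t (p n) 1 - H t x 1 < \<epsilon>" using n DERIV_imp_deriv[OF bx] by simp
          have fz: "H t 1 (q m) - H t 1 z < \<epsilon>" using m DERIV_imp_deriv[OF bz] by simp
          have x0: "0 \<le> H t (p n) 1 - H t x 1"
            using unit_short_derivative_bounds[OF copula3_section_difference[OF K] bx t] p(2)[of n] pD[of n] x by auto
          have z0: "0 \<le> H t 1 (q m) - H t 1 z"
            using unit_short_derivative_bounds[OF copula3_section_difference[OF K] bz t] q(2)[of m] qD[of m] z by auto
          have xz0: "0 \<le> H t (p n) (q m) - H t x z"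
            using unit_short_derivative_bounds[OF copula3_section_difference[OF K] bxz t]
              p(2)[of n] pD[of n] q(2)[of m] qD[of m] x z by auto
          \<comment> \<open>Enlarging \<open>[0, x] x [0, z]\<close> to
            \<open>[0, p n] x [0, q m]\<close> adds a region covered by two full strips, so the
            joint growth is at most the sum of the marginal growths.\<close>
          have "((\<lambda>s. (K (p n) s 1 - K x s 1) + (K 1 s (q m) - K 1 s z) - (K (p n) s (q m) - K x s z))
             has_real_derivative ((H t (p n) 1 - H t x 1) + (H t 1 (q m) - H t 1 z) - (H t (p n) (q m) - H t x z))) (at t)"
            by (intro DERIV_add[OF bx bz, THEN DERIV_diff] bxz)
          then have "0 \<le> (H t (p n) 1 - H t x 1) + (H t 1 (q m) - H t 1 z) - (H t (p n) (q m) - H t x z)"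
          proof (rule derivative_nonneg_on_unit[rotated, OF _ t])
            fix s r :: real assume "0 \<le> s" "s \<le> r" "r \<le> 1"
            then show "K (p n) s 1 - K x s 1 + (K 1 s (q m) - K 1 s z) - (K (p n) s (q m) - K x s z)
              \<le> K (p n) r 1 - K x r 1 + (K 1 r (q m) - K 1 r z) - (K (p n) r (q m) - K x r z)"
              using copula3_slab(1)[OF K, of x "p n" s r "q m" 1] copula3_slab(2)[OF K, of x 1 s r z "q m"]
                p(2)[of n] pD[of n] q(2)[of m] qD[of m] x z by simp
          qed
          then have e: "\<bar>H t (p n) (q m) - H t x z\<bar> \<le> 2 * \<epsilon>"
            using fx fz xz0 by simp
          have I: "H t x 1 \<in> {0..1}" "H t 1 z \<in> {0..1}" "H t (p n) 1 \<in> {0..1}" "H t 1 (q m) \<in> {0..1}"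
            using unit_short_derivative_bounds[OF copula3_section[OF K] dx t]
              unit_short_derivative_bounds[OF copula3_section[OF K] dz t]
              unit_short_derivative_bounds[OF copula3_section[OF K] d[OF p(1) D(2)] t]
              unit_short_derivative_bounds[OF copula3_section[OF K] d[OF D(2) q(1)] t] x z pD qD by auto
          have "Cf t (H t (p n) 1) (H t 1 (q m)) = H t (p n) (q m)"
            using gt Cg(2) p q by (simp add: Cf_def)
          moreover have "\<bar>Cf t (H t (p n) 1) (H t 1 (q m)) - Cf t (H t x 1) (H t 1 z)\<bar>
              \<le> \<bar>H t (p n) 1 - H t x 1\<bar> + \<bar>H t 1 (q m) - H t 1 z\<bar>"
            using I gt by (intro copula2_lipschitz) (auto simp: Cf_def Cg)
          ultimately show ?thesis using e fx fz x0 z0 by linarith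
        qed
        \<comment> \<open>With this \<open>\<epsilon>\<close> a nonzero error would be at most half
          of itself.\<close>
        from this[of "\<bar>Cf t (H t x 1) (H t 1 z) - H t x z\<bar> / 8"]
        show "Cf t (H t x 1) (H t 1 z) = H t x z" by (cases "Cf t (H t x 1) (H t 1 z) = H t x z") auto
      qed
    qed
    moreover have "deriv (A x) t = H t x 1" "deriv (\<lambda>s. B s z) t = H t 1 z" if "t \<in> {0<..<1}" for t
      unfolding H_def using that A B x z by (auto intro: deriv_cong_on_unit)
    ultimately have "AE t in lebesgue. t \<in> {0<..<1} \<longrightarrow>
        Cf t (deriv (A x) t) (deriv (\<lambda>s. B s z) t) = deriv (\<lambda>s. K x s z) t"
      by (auto simp: H_def)
    then show "K x y z = star A Cf B x y z"
      using copula3_boundary[OF K x z] by (intro star_eqI[symmetric] copula3_section[OF K x z] y)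
  qed
qed

section \<open>Equivalence between the three marginals and the three star products\<close>

theorem theorem5p2:
  fixes C12 C13 C23 :: "real \<Rightarrow> real \<Rightarrow> real"
    and Ct :: "real \<Rightarrow> real \<Rightarrow> real \<Rightarrow> real"
  assumes "copula2 C12" and "copula2 C13" and "copula2 C23"
    and "compatible C12 C13 C23"
    and "copula3 Ct"
  shows "(\<forall>u1\<in>{0..1}. \<forall>u2\<in>{0..1}. \<forall>u3\<in>{0..1}.
            Ct u1 u2 1 = C12 u1 u2 \<and> Ct u1 1 u3 = C13 u1 u3 \<and> Ct 1 u2 u3 = C23 u2 u3)
    \<longleftrightarrow>
    (\<exists>CF1 CF2 CF3 :: real \<Rightarrow> real \<Rightarrow> real \<Rightarrow> real.
       (\<forall>t\<in>{0..1}. copula2 (CF1 t) \<and> copula2 (CF2 t) \<and> copula2 (CF3 t)) \<and>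
       (\<forall>u1\<in>{0..1}. \<forall>u2\<in>{0..1}. \<forall>u3\<in>{0..1}.
          Ct u1 u2 u3 = star C13 CF3 (\<lambda>u v. C23 v u) u1 u3 u2 \<and>
          Ct u1 u2 u3 = star C12 CF2 C23 u1 u2 u3 \<and>
          Ct u1 u2 u3 = star (\<lambda>u v. C12 v u) CF1 C13 u2 u1 u3))"
    (is "?marginals \<longleftrightarrow> ?products")
proof
  assume m: ?marginals
  \<comment> \<open>Each product integrates over one variable; permuting \<open>Ct\<close> where
    necessary puts that variable into the middle slot.\<close>
  obtain CF1 where CF1: "\<And>t. copula2 (CF1 t)"
    "\<And>x y z. x \<in> {0..1} \<Longrightarrow> y \<in> {0..1} \<Longrightarrow> z \<in> {0..1} \<Longrightarrow>
      Ct y x z = star (\<lambda>u v. C12 v u) CF1 C13 x y z"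
    by (rule copula3_star_representation[OF copula3_permute(2)[OF assms(5)], of "\<lambda>u v. C12 v u" C13])
      (use m in auto)
  obtain CF2 where CF2: "\<And>t. copula2 (CF2 t)"
    "\<And>x y z. x \<in> {0..1} \<Longrightarrow> y \<in> {0..1} \<Longrightarrow> z \<in> {0..1} \<Longrightarrow> Ct x y z = star C12 CF2 C23 x y z"
    by (rule copula3_star_representation[OF assms(5), of C12 C23]) (use m in auto)
  obtain CF3 where CF3: "\<And>t. copula2 (CF3 t)"
    "\<And>x y z. x \<in> {0..1} \<Longrightarrow> y \<in> {0..1} \<Longrightarrow> z \<in> {0..1} \<Longrightarrow>
      Ct x z y = star C13 CF3 (\<lambda>u v. C23 v u) x y z"
    by (rule copula3_star_representation[OF copula3_permute(1)[OF assms(5)], of C13 "\<lambda>u v. C23 v u"])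
      (use m in auto)
  show ?products
    using CF1 CF2 CF3 by (intro exI[of _ CF1] exI[of _ CF2] exI[of _ CF3]) auto
next
  assume ?products
  then obtain CF1 CF2 CF3 where CF: "\<And>t. t \<in> {0..1} \<Longrightarrow> copula2 (CF2 t)" "\<And>t. t \<in> {0..1} \<Longrightarrow> copula2 (CF3 t)"
    and eq: "\<And>u1 u2 u3. u1 \<in> {0..1} \<Longrightarrow> u2 \<in> {0..1} \<Longrightarrow> u3 \<in> {0..1} \<Longrightarrow>
      Ct u1 u2 u3 = star C13 CF3 (\<lambda>u v. C23 v u) u1 u3 u2"
      "\<And>u1 u2 u3. u1 \<in> {0..1} \<Longrightarrow> u2 \<in> {0..1} \<Longrightarrow> u3 \<in> {0..1} \<Longrightarrow>
      Ct u1 u2 u3 = star C12 CF2 C23 u1 u2 u3"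
    by blast
  \<comment> \<open>The product over the second variable gives \<open>C12\<close> at
    \<open>u3 = 1\<close> and \<open>C23\<close> at \<open>u1 = 1\<close>; the product over the
    third gives \<open>C13\<close> at \<open>u2 = 1\<close>.\<close>
  show ?marginals
  proof (intro ballI conjI)
    fix u1 u2 u3 :: real assume u: "u1 \<in> {0..1}" "u2 \<in> {0..1}" "u3 \<in> {0..1}"
    show "Ct u1 u2 1 = C12 u1 u2"
      using eq(2)[of u1 u2 1] star_one_right[OF CF(1) assms(1,3) u(1,2)] u by simp
    show "Ct u1 1 u3 = C13 u1 u3"
      using eq(1)[of u1 1 u3] star_one_right[OF CF(2) assms(2) copula2_swap[OF assms(3)] u(1,3)] u by simp
    show "Ct 1 u2 u3 = C23 u2 u3"
      using eq(2)[of 1 u2 u3] star_one_left[OF CF(1) assms(1,3) u(3,2)] u by simp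
  qed
qed

end
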